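(* The schematic fragment $\mathsf{Sch}(\mathsf{Inq})$ of inquisitive logic $\mathsf{Inq}$ is undecidable, i.e. there is no algorithm which, given a propositional formula $\varphi$, decides whether $\varphi\in\mathsf{Sch}(\mathsf{Inq})$.
   Context: Formulas are built from a countably infinite set $\mathsf{Prop}$ of propositional letters with $\bot$, $\wedge$, $\to$ and inquisitive disjunction $\vee$ (the language of intuitionistic propositional logic, where the disjunction is read as inquisitive disjunction). A state is a set $s$ of classical valuations $v:\mathsf{Prop}\to\{0,1\}$. Support $s\vDash\varphi$ is defined by: $s\vDash p$ iff $v(p)=1$ for all $v\in s$; $s\vDash\bot$ iff $s=\varnothing$; $s\vDash\varphi\wedge\psi$ iff $s\vDash\varphi$ and $s\vDash\psi$; $s\vDash\varphi\vee\psi$ iff $s\vDash\varphi$ or $s\vDash\psi$; $s\vDash\varphi\to\psi$ iff for all $t\subseteq s$, if $t\vDash\varphi$ then $t\vDash\psi$. Inquisitive logic $\mathsf{Inq}$ is the set of formulas supported by all states. Its schematic fragment is $$\mathsf{Sch}(\mathsf{Inq})=\{\varphi : \sigma(\varphi)\in\mathsf{Inq}\text{ for all substitutions }\sigma\},$$ where a substitution replaces propositional letters uniformly by arbitrary formulas of this language. *)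

theory Defs
  imports Main "HOL-Library.Nat_Bijection"
begin

section \<open>Inquisitive logic\<close>

text \<open>The propositional letters are indexed by the natural numbers; \<open>Or\<close> is inquisitive
  disjunction.\<close>

datatype form =
    Letter nat
  | Bot
  | And form form
  | Or form form
  | Imp form form

type_synonym valuation = "nat \<Rightarrow> bool"
type_synonym state = "valuation set"

primrec supports :: "state \<Rightarrow> form \<Rightarrow> bool" where
  "supports s (Letter p) \<longleftrightarrow> (\<forall>v\<in>s. v p)"
| "supports s Bot \<longleftrightarrow> s = {}"
| "supports s (And \<phi> \<psi>) \<longleftrightarrow> supports s \<phi> \<and> supports s \<psi>"
| "supports s (Or \<phi> \<psi>) \<longleftrightarrow> supports s \<phi> \<or> supports s \<psi>"
| "supports s (Imp \<phi> \<psi>) \<longleftrightarrow> (\<forall>t. t \<subseteq> s \<longrightarrow> supports t \<phi> \<longrightarrow> supports t \<psi>)"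

definition Inq :: "form set" where
  "Inq = {\<phi>. \<forall>s. supports s \<phi>}"

primrec subst :: "(nat \<Rightarrow> form) \<Rightarrow> form \<Rightarrow> form" where
  "subst \<sigma> (Letter p) = \<sigma> p"
| "subst \<sigma> Bot = Bot"
| "subst \<sigma> (And \<phi> \<psi>) = And (subst \<sigma> \<phi>) (subst \<sigma> \<psi>)"
| "subst \<sigma> (Or \<phi> \<psi>) = Or (subst \<sigma> \<phi>) (subst \<sigma> \<psi>)"
| "subst \<sigma> (Imp \<phi> \<psi>) = Imp (subst \<sigma> \<phi>) (subst \<sigma> \<psi>)"

definition Sch :: "form set \<Rightarrow> form set" where
  "Sch L = {\<phi>. \<forall>\<sigma>. subst \<sigma> \<phi> \<in> L}"


section \<open>Decidability\<close>

text \<open>Algorithms are rendered as Kleene's partial recursive functions, given by programs with a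
  big-step semantics: \<open>computes f xs y\<close> says that \<open>f\<close> halts on the argument list \<open>xs\<close> with value
  \<open>y\<close>. Programs carry no arity: for each \<open>k\<close>, the partial functions computed on the
  lists of length \<open>k\<close> are exactly the \<open>k\<close>-ary partial recursive functions.\<close>

datatype recf =
    Zero
  | Succ
  | Proj nat
  | Comp recf "recf list"
  | PrimRec recf recf
  | Mu recf

text \<open>In \<open>PrimRec f g\<close> the recursion argument is the first one, and \<open>g\<close> receives the predecessor,
  the previous value and the parameters, in this order. In \<open>Mu f\<close> the argument searched for is the
  first one of \<open>f\<close>, and all earlier values of \<open>f\<close> have to be defined.\<close>

inductive computes :: "recf \<Rightarrow> nat list \<Rightarrow> nat \<Rightarrow> bool" where
  Zero: "computes Zero xs 0"
| Succ: "computes Succ [x] (Suc x)"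
| Proj: "i < length xs \<Longrightarrow> computes (Proj i) xs (xs ! i)"
| Comp: "list_all2 (\<lambda>g y. computes g xs y) gs ys \<Longrightarrow> computes f ys z \<Longrightarrow>
    computes (Comp f gs) xs z"
| PrimRec_0: "computes f xs y \<Longrightarrow> computes (PrimRec f g) (0 # xs) y"
| PrimRec_Suc: "computes (PrimRec f g) (n # xs) r \<Longrightarrow> computes g (n # r # xs) y \<Longrightarrow>
    computes (PrimRec f g) (Suc n # xs) y"
| Mu: "computes f (n # xs) 0 \<Longrightarrow> (\<forall>m<n. \<exists>k. computes f (m # xs) (Suc k)) \<Longrightarrow>
    computes (Mu f) xs n"

inductive_cases computes_ZeroE: "computes Zero xs y"
inductive_cases computes_SuccE: "computes Succ xs y"
inductive_cases computes_ProjE: "computes (Proj i) xs y"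
inductive_cases computes_CompE: "computes (Comp f gs) xs y"
inductive_cases computes_PrimRec_0E: "computes (PrimRec f g) (0 # xs) y"
inductive_cases computes_PrimRec_SucE: "computes (PrimRec f g) (Suc n # xs) y"
inductive_cases computes_MuE: "computes (Mu f) xs y"

lemma computes_deterministic: "computes f xs y \<Longrightarrow> computes f xs z \<Longrightarrow> y = z"
proof (induction f xs y arbitrary: z rule: computes.induct)
  case (Comp xs gs ys f w)
  from Comp.prems obtain ys' where ys':
    "list_all2 (\<lambda>g y. computes g xs y) gs ys'" "computes f ys' z"
    by (rule computes_CompE)
  have lens: "length gs = length ys" "length gs = length ys'"
    using list_all2_lengthD[OF Comp.IH(1)] list_all2_lengthD[OF ys'(1)] .
  have "ys = ys'"
  proof (rule nth_equalityI)
    show "length ys = length ys'"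
      using lens by simp
    fix i assume i: "i < length ys"
    then show "ys ! i = ys' ! i"
      using list_all2_nthD2[OF Comp.IH(1) i] list_all2_nthD2[OF ys'(1), of i] lens by simp
  qed
  then show ?case using Comp.IH(2) ys'(2) by blast
next
  case (PrimRec_Suc f g n xs r y)
  from PrimRec_Suc.prems obtain r' where
    "computes (PrimRec f g) (n # xs) r'" "computes g (n # r' # xs) z"
    by (rule computes_PrimRec_SucE)
  then show ?case using PrimRec_Suc.IH by blast
next
  case (Mu f n xs)
  from Mu.prems have z: "computes f (z # xs) 0" "\<forall>m<z. \<exists>k. computes f (m # xs) (Suc k)"
    using computes_MuE[OF Mu.prems] by blast+
  show ?case
  proof (rule linorder_cases[of n z])
    assume "n < z"
    then obtain k where "computes f (n # xs) (Suc k)" using z(2) by blast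
    then show ?thesis using Mu.IH(1) by blast
  next
    assume "z < n"
    then show ?thesis using Mu.IH(2) z(1) by blast
  qed
next
  case (PrimRec_0 f xs y g)
  then show ?case by (blast elim: computes_PrimRec_0E)
qed (blast elim: computes_ZeroE computes_SuccE computes_ProjE)+

text \<open>Goedel numbering: a constructor tag paired with the code of the arguments.\<close>

primrec form_code :: "form \<Rightarrow> nat" where
  "form_code (Letter p) = prod_encode (0, p)"
| "form_code Bot = prod_encode (1, 0)"
| "form_code (And \<phi> \<psi>) = prod_encode (2, prod_encode (form_code \<phi>, form_code \<psi>))"
| "form_code (Or \<phi> \<psi>) = prod_encode (3, prod_encode (form_code \<phi>, form_code \<psi>))"
| "form_code (Imp \<phi> \<psi>) = prod_encode (4, prod_encode (form_code \<phi>, form_code \<psi>))"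

lemma form_code_inject: "form_code \<phi> = form_code \<psi> \<longleftrightarrow> \<phi> = \<psi>"
proof (induction \<phi> arbitrary: \<psi>)
  case (Letter p) then show ?case by (cases \<psi>) auto
next
  case Bot then show ?case by (cases \<psi>) auto
next
  case (And \<phi>1 \<phi>2) then show ?case by (cases \<psi>) auto
next
  case (Or \<phi>1 \<phi>2) then show ?case by (cases \<psi>) auto
next
  case (Imp \<phi>1 \<phi>2) then show ?case by (cases \<psi>) auto
qed

text \<open>The program has to halt on the code of every formula. Nothing is required on numbers that
  code no formula; as the set of codes is itself recursive, this makes no difference.\<close>

definition decidable :: "form set \<Rightarrow> bool" where
  "decidable L \<longleftrightarrow>
    (\<exists>f. \<forall>\<phi>. computes f [form_code \<phi>] (if \<phi> \<in> L then 1 else 0))"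

end

theory Submission
  imports Defs "HOL-Library.Countable"
begin

text \<open>A formula lies outside the schematic fragment iff it fails under some assignment of downsets
  of a finite powerset to the letters, i.e. in a Kripke model on the nonempty subsets of a finite set
  \<open>X\<close>. A letter \<open>c\<close> is decided at each point of \<open>X\<close>, and \<open>neg c\<close> holds at a set iff no point of it
  satisfies \<open>c\<close>; such negated letters colour the points and split \<open>X\<close> into sorts. The remaining letters
  restricted to coloured parts are then relations between points of different sorts. An axiom
  \<open>\<forall>x\<in>I. body \<longrightarrow> (\<exists>y\<in>J. head)\<close> becomes a formula evaluated at the sets that contain a single point
  of every sort in \<open>I\<close> and all points of every sort in \<open>J\<close>; these sets contain the required witnesses
  as subsets, so that validity in \<open>X\<close> is the truth of the axiom in a finite many-sorted structure.
  This turns finite satisfiability of such theories into refutability.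

  Finite structures can verify computations: a total preorder makes the points of each sort denote
  an initial segment of the naturals, and for every subprogram \<open>g\<close> a relation claims
  \<open>g(x\<^sub>1, \<dots>, x\<^sub>k) = x\<^sub>0\<close>, where each claim has to be justified by claims for the parts of \<open>g\<close>.
  If \<open>d\<close> decided the fragment, the program that maps the code \<open>k\<close> of a formula \<open>\<theta>\<close> to the answer of
  \<open>d\<close> on \<open>num_form k \<rightarrow> \<theta>\<close> would have such a theory \<open>\<theta>\<close> itself, and running it on its own code
  is contradictory.\<close>

section \<open>Finite models on powersets\<close>

text \<open>Intuitionistic Kripke semantics on subsets ordered by reverse inclusion. The clause for
  \<open>Bot\<close> makes the empty set an inconsistent point, as in support, so that the two
  semantics differ at letters only.\<close>

primrec frc :: "(nat \<Rightarrow> 'w set \<Rightarrow> bool) \<Rightarrow> 'w set \<Rightarrow> form \<Rightarrow> bool" where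
  "frc V s (Letter p) \<longleftrightarrow> V p s"
| "frc V s Bot \<longleftrightarrow> s = {}"
| "frc V s (And \<phi> \<psi>) \<longleftrightarrow> frc V s \<phi> \<and> frc V s \<psi>"
| "frc V s (Or \<phi> \<psi>) \<longleftrightarrow> frc V s \<phi> \<or> frc V s \<psi>"
| "frc V s (Imp \<phi> \<psi>) \<longleftrightarrow> (\<forall>t. t \<subseteq> s \<longrightarrow> frc V t \<phi> \<longrightarrow> frc V t \<psi>)"

text \<open>The states supporting a formula form a downset containing the empty state; these two
  properties are asked of \<open>V\<close>, so that it can stand for a substitution.\<close>

definition persistent :: "(nat \<Rightarrow> 'w set \<Rightarrow> bool) \<Rightarrow> bool" where
  "persistent V \<longleftrightarrow> (\<forall>p. V p {}) \<and> (\<forall>p s t. V p s \<longrightarrow> t \<subseteq> s \<longrightarrow> V p t)"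

lemma frc_empty: "persistent V \<Longrightarrow> frc V {} \<phi>"
  by (induction \<phi>) (auto simp: persistent_def)

lemma frc_mono: "persistent V \<Longrightarrow> frc V s \<phi> \<Longrightarrow> t \<subseteq> s \<Longrightarrow> frc V t \<phi>"
proof (induction \<phi> arbitrary: s t)
  case (Letter p)
  then show ?case unfolding persistent_def frc.simps by blast
next
  case (Imp \<phi> \<psi>)
  then show ?case by (auto dest: subset_trans)
qed auto

section \<open>Substitution instances as forcing, and finite refutations\<close>

lemma supports_empty: "supports {} \<phi>"
  by (induction \<phi>) auto

lemma supports_mono: "supports s \<phi> \<Longrightarrow> t \<subseteq> s \<Longrightarrow> supports t \<phi>"
proof (induction \<phi> arbitrary: s t)
  case (Imp \<phi> \<psi>)
  then show ?case by (auto dest: subset_trans)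
qed auto

lemma supports_subst: "supports s (subst \<sigma> \<phi>) \<longleftrightarrow> frc (\<lambda>p t. supports t (\<sigma> p)) s \<phi>"
  by (induction \<phi> arbitrary: s) auto

lemma persistent_supports: "persistent (\<lambda>p t. supports t (\<sigma> p))"
  by (auto simp: persistent_def supports_empty intro: supports_mono)

primrec letters :: "form \<Rightarrow> nat set" where
  "letters (Letter p) = {p}"
| "letters Bot = {}"
| "letters (And \<phi> \<psi>) = letters \<phi> \<union> letters \<psi>"
| "letters (Or \<phi> \<psi>) = letters \<phi> \<union> letters \<psi>"
| "letters (Imp \<phi> \<psi>) = letters \<phi> \<union> letters \<psi>"

lemma finite_letters: "finite (letters \<phi>)"
  by (induction \<phi>) auto

text \<open>Subsets of an image are images of subsets, so cutting valuations down to a set of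
  letters that contains those of the formula commutes with the clause for
  \<open>Imp\<close>.\<close>

lemma supports_restrict:
  assumes "letters \<phi> \<subseteq> P"
  shows "supports ((\<lambda>v p. p \<in> P \<and> v p) ` s) \<phi> \<longleftrightarrow> supports s \<phi>"
  using assms
proof (induction \<phi> arbitrary: s)
  case (Imp \<phi> \<psi>)
  then show ?case by (simp add: all_subset_image)
qed auto

text \<open>Restricted to the finitely many letters of \<open>\<phi>\<close>, only finitely many
  valuations remain.\<close>

lemma refuted_finitely:
  assumes "\<not> supports s \<phi>"
  obtains t where "finite t" "\<not> supports t \<phi>"
proof
  let ?t = "(\<lambda>v p. p \<in> letters \<phi> \<and> v p) ` s"
  show "\<not> supports ?t \<phi>"
    using assms by (simp add: supports_restrict)
  have "?t \<subseteq> (\<lambda>A p. p \<in> A) ` Pow (letters \<phi>)"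
  proof
    fix w assume "w \<in> ?t"
    then obtain v where "w = (\<lambda>p. p \<in> letters \<phi> \<and> v p)" by blast
    then have "w = (\<lambda>A p. p \<in> A) {p \<in> letters \<phi>. v p}" by auto
    then show "w \<in> (\<lambda>A p. p \<in> A) ` Pow (letters \<phi>)" by blast
  qed
  then show "finite ?t"
    by (rule finite_subset) (simp add: finite_letters)
qed

section \<open>Derived connectives and the realisation of downsets by formulas\<close>

abbreviation neg :: "form \<Rightarrow> form" where
  "neg \<phi> \<equiv> Imp \<phi> Bot"

primrec conj :: "form list \<Rightarrow> form" where
  "conj [] = neg Bot"
| "conj (\<phi> # \<phi>s) = And \<phi> (conj \<phi>s)"

primrec disj :: "form list \<Rightarrow> form" where
  "disj [] = Bot"
| "disj (\<phi> # \<phi>s) = Or \<phi> (disj \<phi>s)"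

lemma frc_conj: "frc V s (conj \<phi>s) \<longleftrightarrow> (\<forall>\<phi>\<in>set \<phi>s. frc V s \<phi>)"
  by (induction \<phi>s) auto

lemma frc_disj: "persistent V \<Longrightarrow> frc V s (disj \<phi>s) \<longleftrightarrow> s = {} \<or> (\<exists>\<phi>\<in>set \<phi>s. frc V s \<phi>)"
  by (induction \<phi>s) (auto simp: frc_empty)

text \<open>By persistence a nonempty set forcing \<open>\<phi>\<close> contains a singleton forcing
  it, so negations are evaluated point by point and behave classically.\<close>

lemma frc_neg:
  assumes "persistent V"
  shows "frc V s (neg \<phi>) \<longleftrightarrow> (\<forall>w\<in>s. \<not> frc V {w} \<phi>)"
proof
  assume "frc V s (neg \<phi>)"
  then show "\<forall>w\<in>s. \<not> frc V {w} \<phi>" by auto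
next
  assume *: "\<forall>w\<in>s. \<not> frc V {w} \<phi>"
  show "frc V s (neg \<phi>)"
    unfolding frc.simps
  proof (intro allI impI)
    fix t assume t: "t \<subseteq> s" "frc V t \<phi>"
    show "t = {}"
    proof (rule ccontr)
      assume "t \<noteq> {}"
      then obtain w where "w \<in> t" by blast
      then show False
        using * t frc_mono[OF assms t(2), of "{w}"] by blast
    qed
  qed
qed

lemma supports_eq_frc: "supports s \<phi> \<longleftrightarrow> frc (\<lambda>p t. \<forall>v\<in>t. v p) s \<phi>"
  by (induction \<phi> arbitrary: s) auto

lemma persistent_letters: "persistent (\<lambda>p t. \<forall>v\<in>t. v p)"
  by (auto simp: persistent_def)

lemmas supports_neg = frc_neg[OF persistent_letters, folded supports_eq_frc]
lemmas supports_conj = frc_conj[of "\<lambda>p t. \<forall>v\<in>t. v p", folded supports_eq_frc]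
lemmas supports_disj = frc_disj[OF persistent_letters, folded supports_eq_frc]

text \<open>The points are coded by valuations that make a single letter true; a downset is then the
  support set of the disjunction of the formulas \<open>below t\<close> over its members \<open>t\<close>.\<close>

lemma realise_downsets:
  fixes X :: "'w::countable set"
  assumes "finite X" "persistent V" "\<not> frc V X \<phi>"
  shows "\<phi> \<notin> Sch Inq"
proof -
  define c :: "'w \<Rightarrow> valuation" where "c x = (\<lambda>p. p = to_nat x)" for x
  \<comment> \<open>The classical disjunction of the letters coding the points in \<open>xs\<close>:
    being a negation, it is tested at each valuation separately.\<close>
  define below :: "'w list \<Rightarrow> form" where
    "below xs = neg (conj (map (\<lambda>x. neg (Letter (to_nat x))) xs))" for xs
  have inj: "inj c"
    unfolding c_def by (rule injI) (metis injD inj_to_nat)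
  have below: "supports (c ` s) (below xs) \<longleftrightarrow> s \<subseteq> set xs" for s xs
    by (auto simp: below_def supports_neg supports_conj c_def simp del: supports.simps(5))
  have "\<exists>l. set l = {t. t \<subseteq> X \<and> V p t}" for p
    by (rule finite_list) (simp add: assms(1))
  then obtain ts where ts: "\<And>p. set (ts p) = {t. t \<subseteq> X \<and> V p t}" by metis
  have "\<exists>l. set l = t" if "t \<subseteq> X" for t
    using finite_list[OF finite_subset[OF that assms(1)]] .
  then obtain list where listed: "\<And>t. t \<subseteq> X \<Longrightarrow> set (list t) = t" by metis
  define \<sigma> where "\<sigma> p = disj (map (\<lambda>t. below (list t)) (ts p))" for p
  have \<sigma>: "supports (c ` s) (\<sigma> p) \<longleftrightarrow> V p s" if "s \<subseteq> X" for s p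
  proof
    assume "supports (c ` s) (\<sigma> p)"
    then have "s = {} \<or> (\<exists>t. t \<subseteq> X \<and> V p t \<and> s \<subseteq> t)"
      by (auto simp: \<sigma>_def supports_disj ts below listed)
    then show "V p s" using assms(2) unfolding persistent_def by blast
  next
    assume "V p s"
    then show "supports (c ` s) (\<sigma> p)"
      using that by (auto simp: \<sigma>_def supports_disj ts below listed)
  qed
  have "supports (c ` s) (subst \<sigma> \<psi>) \<longleftrightarrow> frc V s \<psi>" if "s \<subseteq> X" for s \<psi>
    using that
  proof (induction \<psi> arbitrary: s)
    case (Letter p)
    then show ?case by (simp add: \<sigma>)
  next
    case (Imp \<psi> \<chi>)
    then show ?case by (auto simp: all_subset_image dest: subset_trans)
  qed auto
  then have "\<not> supports (c ` X) (subst \<sigma> \<phi>)" using assms(3) by simp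
  then show ?thesis unfolding Sch_def Inq_def by blast
qed

section \<open>Axioms over many-sorted structures as formulas\<close>

datatype sort = Sort bool nat

text \<open>\<open>Claim b g k 0\<close> says that the value of the program \<open>g\<close> on the points of the sorts
  \<open>Sort b 1, \<dots>, Sort b k\<close> is the point of sort \<open>Sort b 0\<close>; for \<open>t > 0\<close>, \<open>Claim b g k t\<close> is the same
  with intermediate values at the positions above \<open>k\<close>. There are two copies, \<open>b\<close> and \<open>\<not> b\<close>, because
  an axiom can mention only one point per sort and a claim is justified by claims on the other
  copy. \<open>Num b m\<close> says that the point of sort \<open>Sort b 1\<close> denotes \<open>m\<close>, and \<open>Inp\<close> that the point of
  sort \<open>Sort False 1\<close> is the input.\<close>

datatype rsym =
    LT sort sort
  | LE sort sort
  | Inp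
  | Num bool nat
  | Claim bool recf nat nat

instance sort :: countable by countable_datatype
instance recf :: countable by countable_datatype
instance rsym :: countable by countable_datatype

text \<open>\<open>Single\<close> stands for the sets with at most one point of each sort, \<open>Small\<close> for those that
  contain no sort entirely. A point has sort \<open>i\<close> iff it does not satisfy \<open>Colour i\<close>.\<close>

datatype lett = Single | Small | Colour sort | Rel rsym

instance lett :: countable by countable_datatype

text \<open>The numerals get explicit indices: the formula \<open>num_form n\<close> has to be computable from \<open>n\<close>.\<close>

definition letter_index :: "lett \<Rightarrow> nat" where
  "letter_index x = (case x of Rel (Num b k) \<Rightarrow> prod_encode (if b then 0 else 1, k)
    | _ \<Rightarrow> prod_encode (2, to_nat x))"

lemma letter_index_inject: "letter_index x = letter_index y \<longleftrightarrow> x = y"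
  by (auto simp: letter_index_def split: lett.splits rsym.splits if_splits)

abbreviation letter :: "lett \<Rightarrow> form" where
  "letter x \<equiv> Letter (letter_index x)"

text \<open>Position 0 holds the value and positions 1 to \<open>k\<close> the arguments. Above them
  lie the values of the inner programs for \<open>Comp\<close>, the predecessor and the previous
  value for \<open>PrimRec\<close>, and for \<open>Mu\<close> the value 0 of \<open>f\<close> (tag
  1) or a smaller candidate with its value (tag 2).\<close>

fun width :: "recf \<Rightarrow> nat \<Rightarrow> nat \<Rightarrow> nat" where
  "width (Comp f gs) k (Suc 0) = Suc k + length gs"
| "width (PrimRec f g) k (Suc (Suc 0)) = k + 3"
| "width (Mu f) k (Suc 0) = k + 2"
| "width (Mu f) k (Suc (Suc 0)) = k + 3"
| "width _ k _ = Suc k"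

fun sorts :: "rsym \<Rightarrow> sort list" where
  "sorts (LT i j) = [i, j]"
| "sorts (LE i j) = [i, j]"
| "sorts Inp = [Sort False 1]"
| "sorts (Num b k) = [Sort b 1]"
| "sorts (Claim b g k t) = map (Sort b) [0..<width g k t]"

text \<open>This keeps the letter of a relation vacuously true at the empty set, as persistence
  demands.\<close>

lemma sorts_nonempty: "sorts r \<noteq> []"
proof (cases r)
  case (Claim b g k t)
  have "width g k t > 0" by (induction g k t rule: width.induct) auto
  then show ?thesis using Claim by simp
qed auto

text \<open>\<open>Ax I B H\<close> is the axiom \<open>\<forall>x\<in>I. \<Inter>B \<longrightarrow> (\<Union>(J, R)\<in>H. \<exists>y\<in>J. \<Inter>R)\<close>.\<close>

datatype axm = Ax (univ: "sort list") (body: "rsym list") (heads: "(sort list \<times> rsym list) list")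

abbreviation exsorts :: "(sort list \<times> rsym list) list \<Rightarrow> sort list" where
  "exsorts H \<equiv> concat (map fst H)"

definition asorts :: "axm \<Rightarrow> sort set" where
  "asorts A = set (univ A) \<union> set (exsorts (heads A))"

text \<open>A universal sort is represented by one of its points and an existential sort by all of
  them, so no sort may be both. Some universal sort is required so that the set at which the axiom
  is evaluated is nonempty.\<close>

definition wf_axm :: "axm \<Rightarrow> bool" where
  "wf_axm A \<longleftrightarrow> univ A \<noteq> [] \<and> set (univ A) \<inter> set (exsorts (heads A)) = {} \<and>
    (\<forall>r\<in>set (body A). set (sorts r) \<subseteq> set (univ A)) \<and>
    (\<forall>(J, R)\<in>set (heads A). \<forall>r\<in>set R. set (sorts r) \<subseteq> set (univ A) \<union> set J)"

definition sat :: "(sort \<Rightarrow> 'd set) \<Rightarrow> (rsym \<Rightarrow> (sort \<Rightarrow> 'd) \<Rightarrow> bool) \<Rightarrow> axm \<Rightarrow> bool" where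
  "sat D rel A \<longleftrightarrow> (\<forall>a. (\<forall>i\<in>set (univ A). a i \<in> D i) \<longrightarrow> (\<forall>r\<in>set (body A). rel r a) \<longrightarrow>
    (\<exists>(J, R)\<in>set (heads A). \<exists>a'. (\<forall>i\<in>set (univ A). a' i = a i) \<and> (\<forall>j\<in>set J. a' j \<in> D j) \<and>
      (\<forall>r\<in>set R. rel r a')))"

definition local_rel :: "(rsym \<Rightarrow> (sort \<Rightarrow> 'd) \<Rightarrow> bool) \<Rightarrow> bool" where
  "local_rel rel \<longleftrightarrow> (\<forall>r a a'. (\<forall>i\<in>set (sorts r). a i = a' i) \<longrightarrow> rel r a \<longrightarrow> rel r a')"

abbreviation colour :: "sort \<Rightarrow> form" where
  "colour i \<equiv> neg (letter (Colour i))"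

text \<open>A negated conjunction is a classical disjunction: each point has some colour in
  \<open>I\<close>, whereas \<open>Or\<close> would ask for one colour common to all points.\<close>

abbreviation coloured :: "sort list \<Rightarrow> form" where
  "coloured I \<equiv> neg (conj (map (\<lambda>i. neg (colour i)) I))"

definition on :: "sort list \<Rightarrow> lett \<Rightarrow> form" where
  "on I x = Imp (coloured I) (letter x)"

text \<open>For each alternative the premise says that no subset witnesses it; the conclusion discards the
  sets that lack a point of a universal sort or do not contain an existential sort entirely.\<close>

definition ax_form :: "axm \<Rightarrow> form" where
  "ax_form A = Imp
    (conj (map (\<lambda>i. on [i] Single) (univ A) @ map (\<lambda>r. on (sorts r) (Rel r)) (body A) @
      map (\<lambda>(J, R). Imp (conj (map (\<lambda>r. on (sorts r) (Rel r)) R))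
        (disj (map (\<lambda>i. neg (colour i)) (univ A @ J)))) (heads A)))
    (disj (map (\<lambda>i. neg (colour i)) (univ A) @ map (\<lambda>j. on [j] Small) (exsorts (heads A))))"

text \<open>Under the double negation \<open>Single\<close> is asked of singletons only; the plain
  letter would allow the whole set just one point per sort.\<close>

definition sort_forms :: "sort list \<Rightarrow> form list" where
  "sort_forms S = neg (neg (letter Single)) #
    concat (map (\<lambda>i. map (\<lambda>j. neg (And (colour i) (colour j))) (filter (\<lambda>j. i \<noteq> j) S)) S)"

text \<open>Refuting the conclusion keeps every sort from being small. As \<open>Small\<close> holds
  at the empty set, every sort is then inhabited.\<close>

definition theory_form :: "sort list \<Rightarrow> axm list \<Rightarrow> form" where
  "theory_form S As = Imp (conj (sort_forms S @ map ax_form As)) (disj (map (\<lambda>i. on [i] Small) S))"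

section \<open>Forcing of axioms in terms of coloured parts\<close>

definition part :: "(nat \<Rightarrow> 'w set \<Rightarrow> bool) \<Rightarrow> 'w set \<Rightarrow> sort list \<Rightarrow> 'w set" where
  "part V s I = {w \<in> s. \<exists>i\<in>set I. \<not> V (letter_index (Colour i)) {w}}"

lemma part_subset: "part V s I \<subseteq> s"
  by (auto simp: part_def)

lemma part_part: "part V (part V s I) I = part V s I"
  by (auto simp: part_def)

lemma part_mono: "t \<subseteq> s \<Longrightarrow> part V t I \<subseteq> part V s I"
  by (auto simp: part_def)

lemma frc_colour_point:
  assumes "persistent V"
  shows "frc V {w} (neg (colour i)) \<longleftrightarrow> V (letter_index (Colour i)) {w}"
  unfolding frc_neg[OF assms] by simp

lemma frc_colour:
  assumes "persistent V"
  shows "frc V s (neg (colour i)) \<longleftrightarrow> part V s [i] = {}"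
  unfolding frc_neg[OF assms] part_def by (simp add: Ball_def)

lemma frc_coloured:
  assumes "persistent V"
  shows "frc V s (coloured I) \<longleftrightarrow> part V s I = s"
proof -
  have "frc V s (coloured I) \<longleftrightarrow> (\<forall>w\<in>s. \<exists>i\<in>set I. \<not> V (letter_index (Colour i)) {w})"
    unfolding frc_neg[OF assms, of s "conj _"] frc_conj set_map ball_simps frc_colour_point[OF assms]
    by blast
  then show ?thesis unfolding part_def by blast
qed

text \<open>The part of \<open>s\<close> with colours in \<open>I\<close> is the largest subset
  forcing \<open>coloured I\<close>, so by persistence the letter need only be checked
  there.\<close>

lemma frc_on:
  assumes "persistent V"
  shows "frc V s (on I x) \<longleftrightarrow> V (letter_index x) (part V s I)"
proof
  assume "frc V s (on I x)"
  then have "\<forall>t\<subseteq>s. part V t I = t \<longrightarrow> V (letter_index x) t"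
    unfolding on_def frc.simps(5)[of V s] frc_coloured[OF assms] by simp
  then show "V (letter_index x) (part V s I)"
    using part_subset part_part by metis
next
  assume *: "V (letter_index x) (part V s I)"
  have "V (letter_index x) t" if "t \<subseteq> s" "part V t I = t" for t
  proof -
    have "t \<subseteq> part V s I" using part_mono[OF that(1), of V I] that(2) by simp
    then show ?thesis using * assms unfolding persistent_def by blast
  qed
  then show "frc V s (on I x)"
    unfolding on_def frc.simps(5)[of V s] frc_coloured[OF assms] by simp
qed

lemma frc_ax_form:
  assumes "persistent V"
  shows "frc V s (ax_form A) \<longleftrightarrow> (\<forall>t. t \<subseteq> s \<longrightarrow>
    (\<forall>i\<in>set (univ A). V (letter_index Single) (part V t [i])) \<and>
    (\<forall>r\<in>set (body A). V (letter_index (Rel r)) (part V t (sorts r))) \<and>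
    \<not> (\<exists>(J, R)\<in>set (heads A). \<exists>u\<subseteq>t. u \<noteq> {} \<and>
      (\<forall>r\<in>set R. V (letter_index (Rel r)) (part V u (sorts r))) \<and>
      (\<forall>i\<in>set (univ A) \<union> set J. part V u [i] \<noteq> {})) \<longrightarrow>
    t = {} \<or> (\<exists>i\<in>set (univ A). part V t [i] = {}) \<or>
    (\<exists>j\<in>set (exsorts (heads A)). V (letter_index Small) (part V t [j])))"
proof -
  have head: "frc V t (Imp (conj (map (\<lambda>r. on (sorts r) (Rel r)) R))
        (disj (map (\<lambda>i. neg (colour i)) (univ A @ J)))) \<longleftrightarrow>
      \<not> (\<exists>u\<subseteq>t. u \<noteq> {} \<and> (\<forall>r\<in>set R. V (letter_index (Rel r)) (part V u (sorts r))) \<and>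
      (\<forall>i\<in>set (univ A) \<union> set J. part V u [i] \<noteq> {}))" for t J R
    unfolding frc.simps(5)[of V t] frc_conj frc_disj[OF assms] set_map ball_simps bex_simps
      frc_on[OF assms] frc_colour[OF assms] set_append by meson
  have heads: "(\<forall>\<phi>\<in>set (map (\<lambda>(J, R). Imp (conj (map (\<lambda>r. on (sorts r) (Rel r)) R))
        (disj (map (\<lambda>i. neg (colour i)) (univ A @ J)))) (heads A)). frc V t \<phi>) \<longleftrightarrow>
      \<not> (\<exists>(J, R)\<in>set (heads A). \<exists>u\<subseteq>t. u \<noteq> {} \<and>
      (\<forall>r\<in>set R. V (letter_index (Rel r)) (part V u (sorts r))) \<and>
      (\<forall>i\<in>set (univ A) \<union> set J. part V u [i] \<noteq> {}))" for t
  proof -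
    have "frc V t ((\<lambda>(J, R). Imp (conj (map (\<lambda>r. on (sorts r) (Rel r)) R))
        (disj (map (\<lambda>i. neg (colour i)) (univ A @ J)))) h) \<longleftrightarrow>
      \<not> (case h of (J, R) \<Rightarrow> \<exists>u\<subseteq>t. u \<noteq> {} \<and>
      (\<forall>r\<in>set R. V (letter_index (Rel r)) (part V u (sorts r))) \<and>
      (\<forall>i\<in>set (univ A) \<union> set J. part V u [i] \<noteq> {}))" for h
      by (cases h) (simp only: prod.case head)
    then show ?thesis unfolding set_map ball_simps by simp
  qed
  show ?thesis
    unfolding ax_form_def frc.simps(5)[of V s] frc_conj frc_disj[OF assms] set_append ball_Un bex_Un
      heads
    unfolding set_map ball_simps bex_simps frc_on[OF assms] frc_colour[OF assms]
    by (rule refl)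
qed

lemma disjoint_in_sort_forms:
  assumes "i \<in> set S" "j \<in> set S" "i \<noteq> j"
  shows "neg (And (colour i) (colour j)) \<in> set (sort_forms S)"
  using assms by (simp add: sort_forms_def) blast

lemma wf_head:
  assumes "wf_axm A" "(J, R) \<in> set (heads A)" "r \<in> set R"
  shows "set (sorts r) \<subseteq> set (univ A) \<union> set J"
  using assms unfolding wf_axm_def by (metis (no_types, lifting) case_prod_conv)

section \<open>Structures and refutations\<close>

text \<open>From a refuting model to a structure: the domain of a sort is the part of
  \<open>X\<close> with its colour, and a relation holds of a tuple if its letter holds at the set
  of the points of the tuple. This loses no information, because the points have distinct
  sorts.\<close>

lemma structure_of_model:
  assumes V: "persistent V"
    and sorts: "\<forall>\<phi>\<in>set (sort_forms S). frc V X \<phi>"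
    and large: "\<forall>i\<in>set S. \<not> V (letter_index Small) (part V X [i])"
    and A: "frc V X (ax_form A)" "wf_axm A" "asorts A \<subseteq> set S"
  shows "sat (\<lambda>i. part V X [i]) (\<lambda>r a. V (letter_index (Rel r)) (a ` set (sorts r))) A"
  unfolding sat_def
proof (intro allI impI)
  let ?c = "\<lambda>i w. \<not> V (letter_index (Colour i)) {w}"
  have V_mono: "V p t" if "V p s" "t \<subseteq> s" for p s t
    using V that unfolding persistent_def by blast
  have single: "V (letter_index Single) {w}" if "w \<in> X" for w
  proof -
    have "frc V X (neg (neg (letter Single)))"
      using sorts by (simp add: sort_forms_def)
    then show ?thesis using that unfolding frc_neg[OF V] by simp
  qed
  have disjoint: "i = j" if "w \<in> X" "?c i w" "?c j w" "i \<in> set S" "j \<in> set S" for w i j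
  proof (rule ccontr)
    assume "i \<noteq> j"
    then have "frc V X (neg (And (colour i) (colour j)))"
      using sorts disjoint_in_sort_forms[OF that(4,5)] by blast
    then have "\<not> frc V {w} (And (colour i) (colour j))"
      using that(1) unfolding frc_neg[OF V] by blast
    then show False using that(2,3) unfolding frc.simps(3) frc_neg[OF V] by simp
  qed
  obtain I B H where AI: "A = Ax I B H" by (cases A)
  have wf: "I \<noteq> []" "set I \<inter> set (exsorts H) = {}"
      "\<And>r. r \<in> set B \<Longrightarrow> set (sorts r) \<subseteq> set I"
      "set I \<subseteq> set S" "set (exsorts H) \<subseteq> set S"
    using A(2,3) unfolding AI wf_axm_def asorts_def axm.sel by blast+
  note wf_R = wf_head[OF A(2), unfolded AI axm.sel]
  fix a
  assume a: "\<forall>i\<in>set (univ A). a i \<in> part V X [i]"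
    and body: "\<forall>r\<in>set (body A). V (letter_index (Rel r)) (a ` set (sorts r))"
  have a': "a i \<in> X" "?c i (a i)" if "i \<in> set I" for i
    using a that by (auto simp: AI part_def)
  \<comment> \<open>At this set the conclusion of the formula of the axiom fails, while the premises
    \<open>Single\<close> and the body hold. Hence the premise denying all alternatives has to fail,
    which produces a subset \<open>u\<close> with witnesses.\<close>
  define s where "s = a ` set I \<union> (\<Union>j\<in>set (exsorts H). part V X [j])"
  have sX: "s \<subseteq> X" using a' by (auto simp: s_def part_def)
  have part_s: "w = a i" if "w \<in> s" "?c i w" "i \<in> set I" for w i
  proof -
    have iS: "i \<in> set S" using wf that by blast
    show ?thesis using that(1) unfolding s_def
    proof
      assume "w \<in> a ` set I"
      then obtain j where "w = a j" "j \<in> set I" by blast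
      then show ?thesis using disjoint[of w i j] a' that(2) iS wf(4) by blast
    next
      assume "w \<in> (\<Union>j\<in>set (exsorts H). part V X [j])"
      then obtain j where j: "j \<in> set (exsorts H)" "w \<in> X" "?c j w" by (auto simp: part_def)
      then have "i = j" using disjoint[of w i j] that(2) iS wf(5) by blast
      then show ?thesis using j wf(2) that(3) by blast
    qed
  qed
  have ne: "s \<noteq> {}" using wf(1) unfolding s_def by (cases I) auto
  have un: "part V s [i] \<noteq> {}" if "i \<in> set I" for i
    using a'[OF that] that by (auto simp: part_def s_def)
  have lg: "\<not> V (letter_index Small) (part V s [j])" if "j \<in> set (exsorts H)" for j
  proof
    assume "V (letter_index Small) (part V s [j])"
    moreover have "part V X [j] \<subseteq> part V s [j]"
      using that by (auto simp: s_def part_def simp del: set_concat set_map)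
    ultimately show False using large wf(5) that V_mono by blast
  qed
  have sg: "V (letter_index Single) (part V s [i])" if i: "i \<in> set I" for i
  proof -
    have "part V s [i] \<subseteq> {a i}" using part_s[OF _ _ i] by (auto simp: part_def)
    then show ?thesis using V_mono single a'(1)[OF i] by blast
  qed
  have bd: "V (letter_index (Rel r)) (part V s (sorts r))" if r: "r \<in> set B" for r
  proof -
    have "part V s (sorts r) \<subseteq> a ` set (sorts r)"
      using part_s wf(3)[OF r] unfolding part_def by blast
    then show ?thesis using V_mono body r unfolding AI axm.sel by blast
  qed
  note imp = A(1)[unfolded AI frc_ax_form[OF V] axm.sel, THEN spec, THEN mp, OF sX]
  have "\<exists>(J, R)\<in>set H. \<exists>u\<subseteq>s. u \<noteq> {} \<and>
      (\<forall>r\<in>set R. V (letter_index (Rel r)) (part V u (sorts r))) \<and>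
      (\<forall>i\<in>set I \<union> set J. part V u [i] \<noteq> {})" (is ?witness)
  proof (rule ccontr)
    assume "\<not> ?witness"
    then have "s = {} \<or> (\<exists>i\<in>set I. part V s [i] = {}) \<or>
        (\<exists>j\<in>set (exsorts H). V (letter_index Small) (part V s [j]))"
      by (intro mp[OF imp] conjI ballI sg bd)
    then show False
      using ne un lg by (elim disjE bexE) (blast+)
  qed
  then obtain J R u where JR: "(J, R) \<in> set H" "u \<subseteq> s"
      "\<forall>r\<in>set R. V (letter_index (Rel r)) (part V u (sorts r))"
      "\<forall>i\<in>set I \<union> set J. part V u [i] \<noteq> {}" by blast
  from JR(4) have "\<forall>i\<in>set I \<union> set J. \<exists>w. w \<in> u \<and> ?c i w"
    unfolding part_def by auto
  \<comment> \<open>One point of \<open>u\<close> per sort; at the universal sorts it can only be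
    the given one, since \<open>s\<close> has no other.\<close>
  then obtain b where b: "\<And>i. i \<in> set I \<union> set J \<Longrightarrow> b i \<in> u \<and> ?c i (b i)" by metis
  show "\<exists>(J, R)\<in>set (heads A). \<exists>a'. (\<forall>i\<in>set (univ A). a' i = a i) \<and>
      (\<forall>j\<in>set J. a' j \<in> part V X [j]) \<and>
      (\<forall>r\<in>set R. V (letter_index (Rel r)) (a' ` set (sorts r)))"
    unfolding AI axm.sel
  proof (rule bexI[OF _ JR(1)], unfold prod.case, intro exI conjI ballI)
    fix i assume "i \<in> set I"
    then show "b i = a i" using part_s b JR(2) by blast
  next
    fix j assume "j \<in> set J"
    then have "b j \<in> X" "?c j (b j)" using b[of j] JR(2) sX by blast+
    then show "b j \<in> part V X [j]" unfolding part_def by simp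
  next
    fix r assume r: "r \<in> set R"
    then have "b ` set (sorts r) \<subseteq> part V u (sorts r)"
      using wf_R[OF JR(1) r] b unfolding part_def by blast
    then show "V (letter_index (Rel r)) (b ` set (sorts r))"
      using V_mono JR(3) r by blast
  qed
qed

section \<open>The model of a structure on the numbers up to N\<close>

text \<open>Points are pairs of a sort and a number. A relation letter holds at a set if every tuple
  drawn from the set satisfies the relation, which makes it persistent; indices that code no
  \<open>lett\<close> hold everywhere.\<close>

definition std :: "nat \<Rightarrow> (rsym \<Rightarrow> (sort \<Rightarrow> nat) \<Rightarrow> bool) \<Rightarrow> nat \<Rightarrow> (sort \<times> nat) set \<Rightarrow> bool" where
  "std N rel p s \<longleftrightarrow> (\<forall>x. p = letter_index x \<longrightarrow> (case x of
      Single \<Rightarrow> \<forall>i m n. (i, m) \<in> s \<longrightarrow> (i, n) \<in> s \<longrightarrow> m = n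
    | Small \<Rightarrow> \<forall>i. \<not> {i} \<times> {..N} \<subseteq> s
    | Colour i \<Rightarrow> \<forall>w\<in>s. fst w \<noteq> i
    | Rel r \<Rightarrow> \<forall>a. (\<forall>i\<in>set (sorts r). (i, a i) \<in> s) \<longrightarrow> rel r a))"

lemma std_letter:
  "std N rel (letter_index Single) s \<longleftrightarrow> (\<forall>i m n. (i, m) \<in> s \<longrightarrow> (i, n) \<in> s \<longrightarrow> m = n)"
  "std N rel (letter_index Small) s \<longleftrightarrow> (\<forall>i. \<not> {i} \<times> {..N} \<subseteq> s)"
  "std N rel (letter_index (Colour i)) s \<longleftrightarrow> (\<forall>w\<in>s. fst w \<noteq> i)"
  "std N rel (letter_index (Rel r)) s \<longleftrightarrow> (\<forall>a. (\<forall>i\<in>set (sorts r). (i, a i) \<in> s) \<longrightarrow> rel r a)"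
  by (simp_all add: std_def letter_index_inject)

lemma persistent_std: "persistent (std N rel)"
  unfolding persistent_def
proof (intro conjI allI impI)
  fix p show "std N rel p {}"
    unfolding std_def
  proof (intro allI impI)
    fix x
    show "case x of
      Single \<Rightarrow> \<forall>i m n. (i, m) \<in> {} \<longrightarrow> (i, n) \<in> {} \<longrightarrow> m = n
    | Small \<Rightarrow> \<forall>i. \<not> {i} \<times> {..N} \<subseteq> {}
    | Colour i \<Rightarrow> \<forall>w\<in>{}. fst w \<noteq> i
    | Rel r \<Rightarrow> \<forall>a. (\<forall>i\<in>set (sorts r). (i, a i) \<in> {}) \<longrightarrow> rel r a"
    proof (cases x)
      case (Rel r)
      then show ?thesis using hd_in_set[OF sorts_nonempty[of r]] unfolding Rel lett.case by blast
    qed auto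
  qed
next
  fix p s t assume *: "std N rel p s" "t \<subseteq> s"
  show "std N rel p t"
    unfolding std_def
  proof (intro allI impI)
    fix x assume p: "p = letter_index x"
    show "case x of
      Single \<Rightarrow> \<forall>i m n. (i, m) \<in> t \<longrightarrow> (i, n) \<in> t \<longrightarrow> m = n
    | Small \<Rightarrow> \<forall>i. \<not> {i} \<times> {..N} \<subseteq> t
    | Colour i \<Rightarrow> \<forall>w\<in>t. fst w \<noteq> i
    | Rel r \<Rightarrow> \<forall>a. (\<forall>i\<in>set (sorts r). (i, a i) \<in> t) \<longrightarrow> rel r a"
      using * unfolding p by (cases x) (simp_all only: std_letter lett.case, blast+)
  qed
qed

lemma part_std: "part (std N rel) s I = {w \<in> s. fst w \<in> set I}"
  by (auto simp: part_def std_letter)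

text \<open>A subset \<open>t\<close> violating the formula would contain one point of each
  universal sort and all points of each existential sort. The points given by the axiom then lie in
  \<open>t\<close> and form a subset that the premise excludes.\<close>

lemma std_ax_form:
  assumes "local_rel rel" "sat (\<lambda>_. {..N}) rel A" "wf_axm A" "s \<subseteq> UNIV \<times> {..N}"
  shows "frc (std N rel) s (ax_form A)"
  unfolding frc_ax_form[OF persistent_std] part_std std_letter
proof (intro allI impI, elim conjE, rule ccontr)
  obtain I B H where AI: "A = Ax I B H" by (cases A)
  fix t assume t: "t \<subseteq> s"
    and single: "\<forall>i\<in>set (univ A). \<forall>ia m n. (ia, m) \<in> {w \<in> t. fst w \<in> set [i]} \<longrightarrow>
       (ia, n) \<in> {w \<in> t. fst w \<in> set [i]} \<longrightarrow> m = n"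
    and body: "\<forall>r\<in>set (body A). \<forall>a. (\<forall>i\<in>set (sorts r). (i, a i) \<in> {w \<in> t. fst w \<in> set (sorts r)}) \<longrightarrow> rel r a"
    and none: "\<not> (\<exists>(J, R)\<in>set (heads A). \<exists>u\<subseteq>t. u \<noteq> {} \<and>
       (\<forall>r\<in>set R. \<forall>a. (\<forall>i\<in>set (sorts r). (i, a i) \<in> {w \<in> u. fst w \<in> set (sorts r)}) \<longrightarrow> rel r a) \<and>
       (\<forall>i\<in>set (univ A) \<union> set J. {w \<in> u. fst w \<in> set [i]} \<noteq> {}))"
    and concl: "\<not> (t = {} \<or> (\<exists>i\<in>set (univ A). {w \<in> t. fst w \<in> set [i]} = {}) \<or>
       (\<exists>j\<in>set (exsorts (heads A)). \<forall>i. \<not> {i} \<times> {..N} \<subseteq> {w \<in> t. fst w \<in> set [j]}))"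
  have nonempty: "\<forall>i\<in>set I. {w \<in> t. fst w \<in> set [i]} \<noteq> {}"
    using concl unfolding AI axm.sel de_Morgan_disj bex_simps by argo
  have large: "\<forall>j\<in>set (exsorts H). \<exists>i. {i} \<times> {..N} \<subseteq> {w \<in> t. fst w \<in> set [j]}"
    using concl unfolding AI axm.sel de_Morgan_disj bex_simps not_all not_not by argo
  have "\<exists>m. (i, m) \<in> t" if "i \<in> set I" for i
    using bspec[OF nonempty that] by auto
  then obtain a where a: "\<And>i. i \<in> set I \<Longrightarrow> (i, a i) \<in> t" by metis
  have full: "(j, m) \<in> t" if j: "j \<in> set (exsorts H)" and m: "m \<le> N" for j m
  proof -
    obtain i where i: "{i} \<times> {..N} \<subseteq> {w \<in> t. fst w \<in> set [j]}"
      using bspec[OF large j] by (rule exE)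
    then have "(i, m) \<in> {w \<in> t. fst w \<in> set [j]}" using m by blast
    then show ?thesis by auto
  qed
  have wf: "I \<noteq> []" "\<And>r. r \<in> set B \<Longrightarrow> set (sorts r) \<subseteq> set I"
    using assms(3) unfolding AI wf_axm_def axm.sel by blast+
  have "\<forall>i\<in>set I. a i \<in> {..N}" using a t assms(4) by blast
  moreover have "\<forall>r\<in>set B. rel r a"
  proof
    fix r assume r: "r \<in> set B"
    have "\<forall>i\<in>set (sorts r). (i, a i) \<in> {w \<in> t. fst w \<in> set (sorts r)}"
      using a wf(2)[OF r] by auto
    then show "rel r a" using body r unfolding AI axm.sel by blast
  qed
  ultimately have "\<exists>(J, R)\<in>set H. \<exists>a'. (\<forall>i\<in>set I. a' i = a i) \<and> (\<forall>j\<in>set J. a' j \<in> {..N}) \<and>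
      (\<forall>r\<in>set R. rel r a')"
    using assms(2) unfolding AI sat_def axm.sel by blast
  then obtain J R a' where JR: "(J, R) \<in> set H" "\<And>i. i \<in> set I \<Longrightarrow> a' i = a i"
      "\<And>j. j \<in> set J \<Longrightarrow> a' j \<in> {..N}" "\<And>r. r \<in> set R \<Longrightarrow> rel r a'" by blast
  \<comment> \<open>One point per sort, so the only tuple to be drawn from \<open>u\<close> is the
    witnessing one, up to sorts that do not matter by \<open>local_rel\<close>.\<close>
  define u where "u = (\<lambda>i. (i, a' i)) ` (set I \<union> set J)"
  have "set J \<subseteq> set (exsorts H)" using JR(1) by force
  then have "(i, a' i) \<in> t" if "i \<in> set I \<union> set J" for i
    using that JR(2,3)[of i] a[of i] full[of i "a' i"] by force
  then have ut: "u \<subseteq> t" unfolding u_def by blast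
  have une: "u \<noteq> {}" using wf(1) by (auto simp: u_def)
  have ur: "rel r b" if r: "r \<in> set R" and
      b: "\<forall>i\<in>set (sorts r). (i, b i) \<in> {w \<in> u. fst w \<in> set (sorts r)}" for r b
  proof -
    have "\<forall>i\<in>set (sorts r). a' i = b i" using b unfolding u_def by auto
    then show ?thesis using assms(1) JR(4)[OF r] unfolding local_rel_def by blast
  qed
  have up: "{w \<in> u. fst w \<in> set [i]} \<noteq> {}" if "i \<in> set I \<union> set J" for i
  proof -
    have "(i, a' i) \<in> {w \<in> u. fst w \<in> set [i]}" using that unfolding u_def by auto
    then show ?thesis by blast
  qed
  have witness: "\<exists>u\<subseteq>t. u \<noteq> {} \<and>
      (\<forall>r\<in>set R. \<forall>b. (\<forall>i\<in>set (sorts r). (i, b i) \<in> {w \<in> u. fst w \<in> set (sorts r)}) \<longrightarrow> rel r b) \<and>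
      (\<forall>i\<in>set I \<union> set J. {w \<in> u. fst w \<in> set [i]} \<noteq> {})"
    by (intro exI[of _ u] conjI ballI allI impI ut une up) (rule ur)
  show False
    by (rule notE[OF none[unfolded AI axm.sel]], rule bexI[OF _ JR(1)]) (simp only: prod.case witness)
qed

lemma std_sort_forms:
  assumes "\<phi> \<in> set (sort_forms S)"
  shows "frc (std N rel) s \<phi>"
proof -
  have "frc (std N rel) s (neg (neg (letter Single)))"
    unfolding frc_neg[OF persistent_std] by (auto simp: std_letter)
  moreover have "frc (std N rel) s (neg (And (colour i) (colour j)))" if "i \<noteq> j" for i j
    using that unfolding frc_neg[OF persistent_std] frc.simps(3) by (auto simp: std_letter)
  moreover have "\<phi> = neg (neg (letter Single)) \<or> (\<exists>i j. i \<noteq> j \<and> \<phi> = neg (And (colour i) (colour j)))"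
    using assms unfolding sort_forms_def list.set set_concat set_map set_filter insert_iff Union_iff
    by (elim disjE bexE imageE; simp only: set_map set_filter; blast)
  ultimately show ?thesis by blast
qed

text \<open>The set of all points of the sorts in \<open>S\<close> forces the premises, and there no
  sort is small. The separate premise \<open>\<phi>\<close> is the place for the axioms about the
  input.\<close>

lemma refutable_if_sat:
  assumes "S \<noteq> []" "local_rel rel" "\<And>A. A \<in> set As \<Longrightarrow> wf_axm A \<and> sat (\<lambda>_. {..N}) rel A"
    and "\<And>s. s \<subseteq> UNIV \<times> {..N} \<Longrightarrow> frc (std N rel) s \<phi>"
  shows "Imp \<phi> (theory_form S As) \<notin> Sch Inq"
proof (rule realise_downsets[OF _ persistent_std])
  let ?X = "set S \<times> {..N}"
  show "finite ?X" by simp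
  have ax: "frc (std N rel) ?X (conj (sort_forms S @ map ax_form As))"
    unfolding frc_conj set_append set_map
  proof (intro ballI, elim UnE imageE)
    show "frc (std N rel) ?X \<psi>" if "\<psi> \<in> set (sort_forms S)" for \<psi>
      using that by (rule std_sort_forms)
    show "frc (std N rel) ?X \<psi>" if "\<psi> = ax_form A" "A \<in> set As" for \<psi> A
      using std_ax_form[OF assms(2), of N A ?X] assms(3)[OF that(2)] that(1) by blast
  qed
  have "\<not> std N rel (letter_index Small) {w \<in> ?X. fst w \<in> set [i]}" if "i \<in> set S" for i
    unfolding std_letter using that by auto
  moreover have "?X \<noteq> {}" using assms(1) by simp
  moreover have "frc (std N rel) ?X (disj (map (\<lambda>i. on [i] Small) S)) \<longleftrightarrow> ?X = {} \<or>
      (\<exists>i\<in>set S. std N rel (letter_index Small) {w \<in> ?X. fst w \<in> set [i]})"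
    unfolding frc_disj[OF persistent_std] set_map bex_simps frc_on[OF persistent_std] part_std
    by (rule refl)
  ultimately have "\<not> frc (std N rel) ?X (disj (map (\<lambda>i. on [i] Small) S))"
    by blast
  moreover have "frc (std N rel) ?X (disj (map (\<lambda>i. on [i] Small) S))"
    if "frc (std N rel) ?X (theory_form S As)"
    using that[unfolded theory_form_def frc.simps(5), THEN spec, THEN mp, THEN mp, OF order_refl ax] .
  ultimately have "\<not> frc (std N rel) ?X (theory_form S As)" by blast
  moreover have "frc (std N rel) ?X \<phi>" by (rule assms(4)) auto
  moreover have "frc (std N rel) ?X (theory_form S As)"
    if "frc (std N rel) ?X (Imp \<phi> (theory_form S As))" "frc (std N rel) ?X \<phi>"
    using that(1)[unfolded frc.simps(5)[of _ ?X \<phi>], THEN spec, THEN mp, THEN mp, OF order_refl that(2)] .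
  ultimately show "\<not> frc (std N rel) ?X (Imp \<phi> (theory_form S As))" by blast
qed

text \<open>The converse: a finite refuting state of a substitution instance gives a structure with
  finite domains. \<open>Bs\<close> collects the axioms that \<open>\<phi>\<close>
  expresses.\<close>

lemma sat_if_refutable:
  assumes "Imp \<phi> (theory_form S As) \<notin> Sch Inq"
    and wf: "\<And>A. A \<in> set As \<union> Bs \<Longrightarrow> wf_axm A \<and> asorts A \<subseteq> set S"
    and \<phi>: "\<And>V (s :: state) A. persistent V \<Longrightarrow> frc V s \<phi> \<Longrightarrow> A \<in> Bs \<Longrightarrow> frc V s (ax_form A)"
  obtains D :: "sort \<Rightarrow> valuation set" and rel where "\<And>i. finite (D i)" "\<And>i. i \<in> set S \<Longrightarrow> D i \<noteq> {}"
    "local_rel rel" "\<And>A. A \<in> set As \<union> Bs \<Longrightarrow> sat D rel A"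
proof -
  obtain \<sigma> s where "\<not> supports s (subst \<sigma> (Imp \<phi> (theory_form S As)))"
    using assms(1) unfolding Sch_def Inq_def by blast
  then obtain s where s: "finite s" "\<not> supports s (subst \<sigma> (Imp \<phi> (theory_form S As)))"
    using refuted_finitely by blast
  define V where "V = (\<lambda>p t. supports t (\<sigma> p))"
  have V: "persistent V" unfolding V_def by (rule persistent_supports)
  have "\<not> frc V s (Imp \<phi> (theory_form S As))"
    using s(2) unfolding supports_subst V_def .
  then obtain t where t: "t \<subseteq> s" "frc V t \<phi>" "\<not> frc V t (theory_form S As)"
    unfolding frc.simps(5)[of V s] by blast
  \<comment> \<open>Two implications are refuted one inside the other: \<open>t\<close> forces
    \<open>\<phi>\<close>, and its subset \<open>X\<close> forces the axioms but not the conclusion.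
    Persistence carries \<open>\<phi>\<close> down to \<open>X\<close>.\<close>
  obtain X where X: "X \<subseteq> t" "frc V X (conj (sort_forms S @ map ax_form As))"
      "\<not> frc V X (disj (map (\<lambda>i. on [i] Small) S))"
    using t(3) unfolding theory_form_def frc.simps(5)[of V t] by blast
  define D where "D i = part V X [i]" for i
  define rel where "rel r a = V (letter_index (Rel r)) (a ` set (sorts r))" for r and a :: "sort \<Rightarrow> valuation"
  have "finite (D i)" for i
    unfolding D_def using finite_subset[OF part_subset] X(1) t(1) s(1) by (meson finite_subset)
  moreover have large: "\<forall>i\<in>set S. \<not> V (letter_index Small) (part V X [i])"
    using X(3) unfolding frc_disj[OF V] set_map bex_simps frc_on[OF V] by blast
  then have "D i \<noteq> {}" if "i \<in> set S" for i
    using that V unfolding D_def persistent_def by metis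
  moreover have "local_rel rel"
    unfolding local_rel_def rel_def by (metis image_cong)
  moreover have "sat D rel A" if A: "A \<in> set As \<union> Bs" for A
    unfolding D_def rel_def
  proof (rule structure_of_model[OF V])
    show "\<forall>\<phi>\<in>set (sort_forms S). frc V X \<phi>"
      using X(2) unfolding frc_conj by simp
    show "\<forall>i\<in>set S. \<not> V (letter_index Small) (part V X [i])" by (fact large)
    show "frc V X (ax_form A)"
    proof (cases "A \<in> Bs")
      case True
      then show ?thesis using frc_mono[OF V \<phi>[OF V t(2)] X(1)] by blast
    next
      case False
      then show ?thesis using A X(2) unfolding frc_conj by simp
    qed
  qed (use wf[OF A] in auto)
  ultimately show thesis by (rule that)
qed

section \<open>The order of the numbers\<close>

text \<open>Subsets are unordered, so that only points of different sorts can be compared.\<close>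

definition base_axms :: "sort list \<Rightarrow> axm list" where
  "base_axms S =
    concat (map (\<lambda>i. concat (map (\<lambda>j. if i = j then [] else
      [Ax [i, j] [] [([], [LT i j]), ([], [LE j i])],
       Ax [i, j] [LT i j, LE j i] [],
       Ax [i, j] [LT i j] [([], [LE i j])],
       Ax [i] [] [([j], [LE i j, LE j i])]] @
      concat (map (\<lambda>k. if k = i \<or> k = j then [] else
        [Ax [i, j, k] [LE i j, LE j k] [([], [LE i k])]]) S)) S)) S)"

lemma set_base_axms:
  "A \<in> set (base_axms S) \<longleftrightarrow> (\<exists>i\<in>set S. \<exists>j\<in>set S. i \<noteq> j \<and>
    (A = Ax [i, j] [] [([], [LT i j]), ([], [LE j i])] \<or>
     A = Ax [i, j] [LT i j, LE j i] [] \<or>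
     A = Ax [i, j] [LT i j] [([], [LE i j])] \<or>
     A = Ax [i] [] [([j], [LE i j, LE j i])] \<or>
     (\<exists>k\<in>set S. k \<noteq> i \<and> k \<noteq> j \<and> A = Ax [i, j, k] [LE i j, LE j k] [([], [LE i k])])))"
proof -
  have if_nil: "x \<in> set (if P then [] else xs) \<longleftrightarrow> \<not> P \<and> x \<in> set xs" for x :: axm and P xs
    by simp
  show ?thesis
    unfolding base_axms_def set_concat set_map image_image UN_iff if_nil set_append Un_iff
    by (simp only: if_nil list.set insert_iff empty_iff de_Morgan_disj simp_thms conj_assoc disj_assoc)
qed

lemma base_axmsI:
  assumes "i \<in> set S" "j \<in> set S" "i \<noteq> j"
  shows "Ax [i, j] [] [([], [LT i j]), ([], [LE j i])] \<in> set (base_axms S)"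
    "Ax [i, j] [LT i j, LE j i] [] \<in> set (base_axms S)"
    "Ax [i, j] [LT i j] [([], [LE i j])] \<in> set (base_axms S)"
    "Ax [i] [] [([j], [LE i j, LE j i])] \<in> set (base_axms S)"
    "k \<in> set S \<Longrightarrow> k \<noteq> i \<Longrightarrow> k \<noteq> j \<Longrightarrow>
      Ax [i, j, k] [LE i j, LE j k] [([], [LE i k])] \<in> set (base_axms S)"
  unfolding set_base_axms using assms by blast+

lemma wf_base_axms:
  assumes "A \<in> set (base_axms S)"
  shows "wf_axm A \<and> asorts A \<subseteq> set S"
  using assms unfolding set_base_axms
  by (elim bexE conjE disjE) (simp_all add: wf_axm_def asorts_def)

text \<open>Ranks in a finite set have no gaps: the next smaller element has rank one less, and the
  descent continues from there.\<close>

lemma rank_onto: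
  fixes C :: "nat set"
  assumes "finite C" "c \<in> C" "m < card {d \<in> C. d < c}"
  shows "\<exists>d\<in>C. card {e \<in> C. e < d} = m"
  using assms
proof (induction c rule: less_induct)
  case (less c)
  define d where "d = Max {d \<in> C. d < c}"
  have ne: "{d \<in> C. d < c} \<noteq> {}" using less.prems(3) by (metis card.empty not_less_zero)
  have d: "d \<in> C" "d < c" "\<And>e. e \<in> C \<Longrightarrow> e < c \<Longrightarrow> e \<le> d"
    using Max_in[OF _ ne] Max_ge[of "{d \<in> C. d < c}"] less.prems(1) unfolding d_def by auto
  have "{e \<in> C. e < c} = insert d {e \<in> C. e < d}" using d by force
  then have "card {e \<in> C. e < c} = Suc (card {e \<in> C. e < d})" using less.prems(1) by simp
  then show ?case
    using less.IH[OF d(2) less.prems(1) d(1)] less.prems(3) d(1) by (auto simp: less_Suc_eq)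
qed

lemma rank_mono:
  fixes C :: "nat set"
  assumes "finite C" "c \<in> C" "d \<in> C"
  shows "card {e \<in> C. e < c} \<le> card {e \<in> C. e < d} \<longleftrightarrow> c \<le> d"
proof
  assume "c \<le> d"
  then show "card {e \<in> C. e < c} \<le> card {e \<in> C. e < d}"
    using assms(1) by (intro card_mono) auto
next
  assume *: "card {e \<in> C. e < c} \<le> card {e \<in> C. e < d}"
  show "c \<le> d"
  proof (rule ccontr)
    assume "\<not> c \<le> d"
    then have "{e \<in> C. e < d} \<subset> {e \<in> C. e < c}" using assms(3) by force
    moreover have "finite {e \<in> C. e < c}" using assms(1) by simp
    ultimately show False using * by (meson psubset_card_mono not_le)
  qed
qed

lemma local_relD:
  assumes "local_rel rel" "\<And>i. i \<in> set (sorts r) \<Longrightarrow> a i = a' i"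
  shows "rel r a \<longleftrightarrow> rel r a'"
  using assms unfolding local_rel_def by metis

text \<open>The interface through which a finite structure is read as arithmetic. By
  \<open>onto\<close>, the numbers below a given point are available in every other sort, so that
  statements about the order determine zero and successor.\<close>

locale numbers =
  fixes D :: "sort \<Rightarrow> 'd set" and rel :: "rsym \<Rightarrow> (sort \<Rightarrow> 'd) \<Rightarrow> bool"
    and val :: "sort \<Rightarrow> 'd \<Rightarrow> nat" and U :: "sort set"
  assumes rel_lt: "\<And>i j a. i \<in> U \<Longrightarrow> j \<in> U \<Longrightarrow> i \<noteq> j \<Longrightarrow> a i \<in> D i \<Longrightarrow> a j \<in> D j \<Longrightarrow>
      rel (LT i j) a \<longleftrightarrow> val i (a i) < val j (a j)"
    and rel_le: "\<And>i j a. i \<in> U \<Longrightarrow> j \<in> U \<Longrightarrow> i \<noteq> j \<Longrightarrow> a i \<in> D i \<Longrightarrow> a j \<in> D j \<Longrightarrow>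
      rel (LE i j) a \<longleftrightarrow> val i (a i) \<le> val j (a j)"
    and onto: "\<And>i j x m. i \<in> U \<Longrightarrow> j \<in> U \<Longrightarrow> i \<noteq> j \<Longrightarrow> x \<in> D i \<Longrightarrow> m < val i x \<Longrightarrow> \<exists>y\<in>D j. val j y = m"
    and loc: "local_rel rel"

text \<open>The sort \<open>r0\<close> is only a yardstick: points of all other sorts are compared by the number of
  points of sort \<open>r0\<close> that lie strictly below them.\<close>

lemma number_structure:
  fixes D :: "sort \<Rightarrow> 'd set"
  assumes fin: "\<And>i. finite (D i)" and loc: "local_rel rel"
    and sat: "\<And>A. A \<in> set (base_axms S) \<Longrightarrow> sat D rel A"
    and r0: "r0 \<in> set S"
  obtains val where "numbers D rel val (set S - {r0})"
proof -
  \<comment> \<open>By \<open>local_rel\<close> only the two updated positions matter, so this is a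
    genuine binary relation between points of distinct sorts.\<close>
  define le where "le i j x y = rel (LE i j) ((\<lambda>_. x)(j := y))" for i j x y
  have rel_le: "rel (LE i j) a \<longleftrightarrow> le i j (a i) (a j)" if "i \<noteq> j" for i j a
    unfolding le_def using that by (intro local_relD[OF loc]) auto
  have rel_lt: "rel (LT i j) a \<longleftrightarrow> \<not> le j i (a j) (a i)"
    if "i \<in> set S" "j \<in> set S" "i \<noteq> j" "a i \<in> D i" "a j \<in> D j" for i j a
  proof -
    have "\<exists>b. b i = a i \<and> b j = a j \<and> (rel (LT i j) b \<or> rel (LE j i) b)"
      using sat[OF base_axmsI(1)[OF that(1-3)]] that(4,5) unfolding sat_def by auto
    then obtain b where b: "b i = a i" "b j = a j" "rel (LT i j) b \<or> rel (LE j i) b" by blast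
    have "rel (LT i j) a \<longleftrightarrow> rel (LT i j) b" using b by (intro local_relD[OF loc]) auto
    then have "rel (LT i j) a \<or> le j i (a j) (a i)"
      using b rel_le[of j i b] that(3) by auto
    moreover have "\<not> (rel (LT i j) a \<and> rel (LE j i) a)"
      using sat[OF base_axmsI(2)[OF that(1-3)]] that(4,5) unfolding sat_def by auto
    ultimately show ?thesis using rel_le[of j i] that(3) by auto
  qed
  have total: "le i j x y \<or> le j i y x"
    if "i \<in> set S" "j \<in> set S" "i \<noteq> j" "x \<in> D i" "y \<in> D j" for i j x y
  proof -
    let ?a = "(\<lambda>_. x)(j := y)"
    have "rel (LT i j) ?a \<Longrightarrow> \<exists>b. b i = x \<and> b j = y \<and> rel (LE i j) b"
      using sat[OF base_axmsI(3)[OF that(1-3)]] that(3-5) unfolding sat_def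
      by (auto dest!: spec[of _ ?a])
    then have "rel (LT i j) ?a \<Longrightarrow> le i j x y"
      using rel_le[OF that(3)] by auto
    then show ?thesis
      using rel_lt[OF that(1-3), of ?a] that(3-5) by auto
  qed
  have trans: "le i k x z"
    if "i \<in> set S" "j \<in> set S" "k \<in> set S" "i \<noteq> j" "k \<noteq> i" "k \<noteq> j" "x \<in> D i" "y \<in> D j" "z \<in> D k"
      "le i j x y" "le j k y z" for i j k x y z
  proof -
    let ?a = "(\<lambda>_. x)(j := y, k := z)"
    have a: "?a i = x" "?a j = y" "?a k = z" using that(4-6) by auto
    have "rel (LE i j) ?a" "rel (LE j k) ?a"
      using that(4-6,10,11) rel_le[of i j ?a] rel_le[of j k ?a] unfolding a by auto
    moreover have "\<forall>l\<in>set [i, j, k]. ?a l \<in> D l" using that(7-9) a by simp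
    ultimately have "\<exists>b. b i = ?a i \<and> b k = ?a k \<and> rel (LE i k) b"
      using sat[OF base_axmsI(5)[OF that(1,2,4,3,5,6)], unfolded sat_def axm.sel, THEN spec[of _ ?a]] by auto
    then show ?thesis using rel_le[of i k] that(5) a by auto
  qed
  have copy: "\<exists>y\<in>D j. le i j x y \<and> le j i y x"
    if "i \<in> set S" "j \<in> set S" "i \<noteq> j" "x \<in> D i" for i j x
  proof -
    have "\<exists>b. b i = x \<and> b j \<in> D j \<and> rel (LE i j) b \<and> rel (LE j i) b"
      using sat[OF base_axmsI(4)[OF that(1-3)], unfolded sat_def axm.sel, THEN spec[of _ "\<lambda>_. x"]]
        that(4) by auto
    then show ?thesis using rel_le[of i j] rel_le[of j i] that(3) by auto
  qed
  \<comment> \<open>By totality these are the points of the yardstick strictly below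
    \<open>x\<close>.\<close>
  define c where "c i x = card {z \<in> D r0. \<not> le i r0 x z}" for i x
  have c: "le i j x y \<longleftrightarrow> c i x \<le> c j y"
    if ij: "i \<in> set S" "j \<in> set S" "i \<noteq> j" "i \<noteq> r0" "j \<noteq> r0" "x \<in> D i" "y \<in> D j" for i j x y
  proof -
    have mono: "{z \<in> D r0. \<not> le i r0 x z} \<subseteq> {z \<in> D r0. \<not> le j r0 y z}"
      if "le i j x y" "i \<in> set S" "j \<in> set S" "i \<noteq> j" "i \<noteq> r0" "j \<noteq> r0" "x \<in> D i" "y \<in> D j" for i j x y
      using trans[OF that(2,3) r0 that(4)] that by blast
    show ?thesis
    proof
      assume "le i j x y"
      then show "c i x \<le> c j y" unfolding c_def using mono[of i j x y] ij fin by (intro card_mono) auto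
    next
      assume *: "c i x \<le> c j y"
      show "le i j x y"
      proof (rule ccontr)
        assume n: "\<not> le i j x y"
        then have "le j i y x" using total[of i j x y] ij by blast
        then have "{z \<in> D r0. \<not> le j r0 y z} \<subseteq> {z \<in> D r0. \<not> le i r0 x z}"
          using mono[of j i y x] ij by blast
        \<comment> \<open>The copy of \<open>y\<close> in the yardstick is strictly below
          \<open>x\<close> but not strictly below \<open>y\<close>, which makes the inclusion
          proper.\<close>
        moreover obtain z where z: "z \<in> D r0" "le j r0 y z" "le r0 j z y"
          using copy[OF ij(2) r0 ij(5,7)] by blast
        moreover have "\<not> le i r0 x z"
          using trans[OF ij(1) r0 ij(2) ij(4) _ _ ij(6) z(1) ij(7)] z(3) n ij(3,5) by blast
        ultimately have "{z \<in> D r0. \<not> le j r0 y z} \<subset> {z \<in> D r0. \<not> le i r0 x z}" by blast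
        then have "c j y < c i x" unfolding c_def using fin by (intro psubset_card_mono) auto
        then show False using * by simp
      qed
    qed
  qed
  \<comment> \<open>The yardstick may contain several points at one level, so the counts can have
    gaps; taking ranks among all counts closes them.\<close>
  define C where "C = (\<Union>i\<in>set S - {r0}. c i ` D i)"
  have C: "finite C" unfolding C_def using fin by auto
  have cC: "c i x \<in> C" if "i \<in> set S - {r0}" "x \<in> D i" for i x
    using that unfolding C_def by blast
  define val where "val i x = card {e \<in> C. e < c i x}" for i x
  have val: "le i j x y \<longleftrightarrow> val i x \<le> val j y"
    if "i \<in> set S - {r0}" "j \<in> set S - {r0}" "i \<noteq> j" "x \<in> D i" "y \<in> D j" for i j x y
    unfolding val_def using that c[of i j x y] rank_mono[OF C cC cC, of i x j y] by auto
  show thesis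
  proof (rule that[of val], unfold_locales)
    show "local_rel rel" by (fact loc)
  next
    fix i j a
    assume ij: "i \<in> set S - {r0}" "j \<in> set S - {r0}" "i \<noteq> j" "a i \<in> D i" "a j \<in> D j"
    show "rel (LT i j) a \<longleftrightarrow> val i (a i) < val j (a j)"
      using rel_lt[of i j a] val[of j i "a j" "a i"] ij by auto
    show "rel (LE i j) a \<longleftrightarrow> val i (a i) \<le> val j (a j)"
      using rel_le[of i j a] val[of i j "a i" "a j"] ij by auto
  next
    fix i j x m
    assume ij: "i \<in> set S - {r0}" "j \<in> set S - {r0}" "i \<noteq> j" "x \<in> D i" "m < val i x"
    obtain d where d: "d \<in> C" "card {e \<in> C. e < d} = m"
      using rank_onto[OF C cC[OF ij(1,4)]] ij(5) unfolding val_def by blast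
    then obtain k z where k: "k \<in> set S - {r0}" "z \<in> D k" "d = c k z" unfolding C_def by blast
    then have kz: "val k z = m" using d unfolding val_def by simp
    show "\<exists>y\<in>D j. val j y = m"
    proof (cases "k = j")
      case True
      then show ?thesis using k kz by blast
    next
      case False
      then obtain y where y: "y \<in> D j" "le k j z y" "le j k y z"
        using copy[of k j z] k ij(2) by blast
      then have "val j y = val k z"
        using val[of k j z y] val[of j k y z] k(1,2) ij(2) False by auto
      then show ?thesis using y kz by blast
    qed
  qed
qed

section \<open>Axioms for programs\<close>

text \<open>All intermediate values are bounded, so that they are available in a finite structure.\<close>

inductive bcomp :: "nat \<Rightarrow> recf \<Rightarrow> nat list \<Rightarrow> nat \<Rightarrow> bool" for N where
  Zero: "bcomp N Zero xs 0"
| Succ: "bcomp N Succ [x] (Suc x)"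
| Proj: "i < length xs \<Longrightarrow> bcomp N (Proj i) xs (xs ! i)"
| Comp: "list_all2 (\<lambda>g y. bcomp N g xs y) gs ys \<Longrightarrow> \<forall>y\<in>set ys. y \<le> N \<Longrightarrow> bcomp N f ys z \<Longrightarrow>
    bcomp N (Comp f gs) xs z"
| PrimRec_0: "bcomp N f xs y \<Longrightarrow> bcomp N (PrimRec f g) (0 # xs) y"
| PrimRec_Suc: "bcomp N (PrimRec f g) (n # xs) r \<Longrightarrow> r \<le> N \<Longrightarrow> bcomp N g (n # r # xs) y \<Longrightarrow>
    bcomp N (PrimRec f g) (Suc n # xs) y"
| Mu: "bcomp N f (n # xs) 0 \<Longrightarrow> (\<forall>m<n. \<exists>k. Suc k \<le> N \<and> bcomp N f (m # xs) (Suc k)) \<Longrightarrow>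
    bcomp N (Mu f) xs n"

lemma bcomp_mono: "bcomp N f xs y \<Longrightarrow> N \<le> M \<Longrightarrow> bcomp M f xs y"
proof (induction rule: bcomp.induct)
  case (Comp xs gs ys f z)
  have "list_all2 (\<lambda>g y. bcomp M g xs y) gs ys"
    using Comp.IH(1) Comp.prems by (auto elim: list_all2_mono)
  then show ?case
  proof (rule bcomp.Comp)
    show "\<forall>y\<in>set ys. y \<le> M" using Comp.hyps Comp.prems by auto
    show "bcomp M f ys z" using Comp.IH Comp.prems by blast
  qed
next
  case (PrimRec_Suc f g n xs r y)
  then show ?case by (meson bcomp.PrimRec_Suc le_trans)
next
  case (Mu f n xs)
  then show ?case by (meson bcomp.Mu le_trans)
qed (auto intro: bcomp.intros)

lemma bounded_family:
  fixes P :: "nat \<Rightarrow> nat \<Rightarrow> bool"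
  assumes "\<And>N M i. P N i \<Longrightarrow> N \<le> M \<Longrightarrow> P M i" "\<And>i. i < n \<Longrightarrow> \<exists>N. P N i"
  shows "\<exists>N. \<forall>i<n. P N i"
  using assms(2)
proof (induction n)
  case (Suc n)
  then obtain N where N: "\<forall>i<n. P N i" by (meson less_SucI)
  obtain M where "P M n" using Suc.prems by blast
  then have "\<forall>i<Suc n. P (max N M) i"
    using N assms(1) by (metis less_Suc_eq max.cobounded1 max.cobounded2)
  then show ?case by blast
qed simp

text \<open>A halting computation involves only finitely many intermediate values, and
  \<open>bcomp\<close> is monotone in the bound.\<close>

lemma computes_bounded: "computes f xs y \<Longrightarrow> \<exists>N. bcomp N f xs y"
proof (induction rule: computes.induct)
  case (Comp xs gs ys f z)
  then have "\<exists>N. bcomp N (gs ! i) xs (ys ! i)" if "i < length gs" for i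
    using that by (simp add: list_all2_conv_all_nth)
  then obtain N where N: "\<forall>i<length gs. bcomp N (gs ! i) xs (ys ! i)"
    using bounded_family[of "\<lambda>N i. bcomp N (gs ! i) xs (ys ! i)"] bcomp_mono by blast
  obtain M where M: "bcomp M f ys z" using Comp.IH(2) by blast
  define K where "K = max (max N M) (Max (insert 0 (set ys)))"
  have K: "N \<le> K" "M \<le> K" "\<forall>y\<in>set ys. y \<le> K" by (auto simp: K_def le_max_iff_disj)
  have "list_all2 (\<lambda>g y. bcomp K g xs y) gs ys"
    using N bcomp_mono[OF _ K(1)] Comp.IH(1) by (auto simp: list_all2_conv_all_nth)
  then show ?case using bcomp.Comp bcomp_mono[OF M K(2)] K(3) by blast
next
  case (PrimRec_Suc f g n xs r y)
  then obtain N M where NM: "bcomp N (PrimRec f g) (n # xs) r" "bcomp M g (n # r # xs) y" by blast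
  let ?K = "max r (max N M)"
  have "bcomp ?K (PrimRec f g) (n # xs) r" "bcomp ?K g (n # r # xs) y"
    using NM by (auto elim: bcomp_mono)
  then show ?case using bcomp.PrimRec_Suc by (meson max.cobounded1)
next
  case (Mu f n xs)
  let ?P = "\<lambda>N m. \<exists>k. Suc k \<le> N \<and> bcomp N f (m # xs) (Suc k)"
  have ex: "\<exists>N. ?P N m" if m: "m < n" for m
  proof -
    obtain k N where "bcomp N f (m # xs) (Suc k)" using Mu.IH(2) m by blast
    then have "bcomp (max N (Suc k)) f (m # xs) (Suc k)" by (rule bcomp_mono) simp
    then show ?thesis by (meson max.cobounded2)
  qed
  have mono: "?P M m" if "?P N m" "N \<le> M" for N M m
    using that by (meson bcomp_mono le_trans)
  have "\<exists>N. \<forall>m<n. ?P N m"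
    by (rule bounded_family) (fact mono, fact ex)
  then obtain N where N: "\<forall>m<n. ?P N m" by (rule exE)
  obtain M where "bcomp M f (n # xs) 0" using Mu.IH(1) by blast
  then have "bcomp (max N M) f (n # xs) 0" by (rule bcomp_mono) simp
  moreover have "\<forall>m<n. ?P (max N M) m"
    using N mono[OF _ max.cobounded1] by blast
  ultimately show ?case by (intro exI) (rule bcomp.Mu)
qed (auto intro: bcomp.intros)

text \<open>Programs carry no arity, so each subprogram is listed with the number of arguments on
  which it is called.\<close>

fun subs :: "recf \<Rightarrow> nat \<Rightarrow> (recf \<times> nat) list" where
  "subs (Comp f gs) k = (Comp f gs, k) # subs f (length gs) @ concat (map (\<lambda>g. subs g k) gs)"
| "subs (PrimRec f g) k = (PrimRec f g, k) # subs f (k - 1) @ subs g (Suc k)"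
| "subs (Mu f) k = (Mu f, k) # subs f (Suc k)"
| "subs f k = [(f, k)]"

section \<open>Axioms that justify claims\<close>

abbreviation same :: "sort \<Rightarrow> sort \<Rightarrow> rsym list" where
  "same i j \<equiv> [LE i j, LE j i]"

text \<open>A claim on copy \<open>b\<close> is backed by a claim for \<open>g\<close> on the other
  copy. Position \<open>qs ! i\<close> is copied to position \<open>i\<close>, so the head of
  \<open>qs\<close> locates the value and the tail the arguments.\<close>

definition call_axm :: "rsym \<Rightarrow> bool \<Rightarrow> nat list \<Rightarrow> recf \<Rightarrow> nat \<Rightarrow> axm" where
  "call_axm r b qs g k = Ax (sorts r) [r] [(map (Sort (\<not> b)) [0..<Suc k],
    Claim (\<not> b) g k 0 # concat (map (\<lambda>i. same (Sort b (qs ! i)) (Sort (\<not> b) i)) [0..<Suc k]))]"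

text \<open>Zero is expressed by the order alone, as having nothing strictly below; the smaller
  point is sought in a sort of the other copy, since points of one sort cannot be compared.\<close>

definition zero_axm :: "rsym \<Rightarrow> bool \<Rightarrow> nat \<Rightarrow> axm" where
  "zero_axm r b p = Ax (sorts r @ [Sort (\<not> b) 0]) [r, LT (Sort (\<not> b) 0) (Sort b p)] []"

definition succ_axms :: "rsym \<Rightarrow> bool \<Rightarrow> nat \<Rightarrow> nat \<Rightarrow> axm list" where
  "succ_axms r b p q = [Ax (sorts r) [r] [([], [LT (Sort b p) (Sort b q)])],
    Ax (sorts r @ [Sort (\<not> b) 0])
      [r, LT (Sort b p) (Sort (\<not> b) 0), LT (Sort (\<not> b) 0) (Sort b q)] []]"

text \<open>Claims are only required to be justified, never to be present: a structure need not contain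
  enough numbers for the computations that it does not claim.\<close>

fun claim_axms :: "bool \<Rightarrow> recf \<Rightarrow> nat \<Rightarrow> axm list" where
  "claim_axms b Zero k = [zero_axm (Claim b Zero k 0) b 0]"
| "claim_axms b Succ k = (let F = Claim b Succ k 0 in
    if k = 1 then succ_axms F b 1 0 else [Ax (sorts F) [F] []])"
| "claim_axms b (Proj i) k = (let F = Claim b (Proj i) k 0 in
    [Ax (sorts F) [F] (if i < k then [([], same (Sort b 0) (Sort b (Suc i)))] else [])])"
| "claim_axms b (Comp f gs) k =
    (let F = Claim b (Comp f gs) k 0; H = Claim b (Comp f gs) k 1; m = length gs in
    Ax (sorts F) [F] [(map (Sort b) [Suc k..<Suc k + m], [H])] #
    call_axm H b (0 # [Suc k..<Suc k + m]) f m #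
    map (\<lambda>j. call_axm H b ((Suc k + j) # [1..<Suc k]) (gs ! j) k) [0..<m])"
| "claim_axms b (PrimRec f g) k =
    (let F = Claim b (PrimRec f g) k 0; H = Claim b (PrimRec f g) k 1; H' = Claim b (PrimRec f g) k 2 in
    if k = 0 then [Ax (sorts F) [F] []] else
    [Ax (sorts F) [F] [([], [H]), ([Sort b (k + 1), Sort b (k + 2)], [H'])],
     zero_axm H b 1, call_axm H b (0 # [2..<Suc k]) f (k - 1)] @ succ_axms H' b (k + 1) 1 @
    [call_axm H' b ((k + 2) # (k + 1) # [2..<Suc k]) (PrimRec f g) k,
     call_axm H' b (0 # (k + 1) # (k + 2) # [2..<Suc k]) g (Suc k)])"
| "claim_axms b (Mu f) k =
    (let F = Claim b (Mu f) k 0; H = Claim b (Mu f) k 1; H' = Claim b (Mu f) k 2 in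
    [Ax (sorts F) [F] [([Sort b (k + 1)], [H])],
     zero_axm H b (k + 1), call_axm H b ((k + 1) # 0 # [1..<Suc k]) f (Suc k),
     Ax (sorts F @ [Sort b (k + 1)]) [F, LT (Sort b (k + 1)) (Sort b 0)]
       [([Sort b (k + 2), Sort (\<not> b) 0], [H', LT (Sort (\<not> b) 0) (Sort b (k + 2))])],
     call_axm H' b ((k + 2) # (k + 1) # [1..<Suc k]) f (Suc k)])"

definition prog_axms :: "recf \<Rightarrow> nat \<Rightarrow> axm list" where
  "prog_axms f k = concat (map (\<lambda>(g, j). claim_axms False g j @ claim_axms True g j) (subs f k))"

lemma claim_axms_in_prog_axms:
  assumes "(g, j) \<in> set (subs f k)" "A \<in> set (claim_axms b g j)"
  shows "A \<in> set (prog_axms f k)"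
proof -
  have "A \<in> set (claim_axms False g j @ claim_axms True g j)" using assms(2) by (cases b) auto
  then show ?thesis using assms(1) unfolding prog_axms_def by force
qed

lemma width_0 [simp]: "width f k 0 = Suc k"
  by (cases f) auto

lemma width_pos: "0 < width g k t"
  by (induction g k t rule: width.induct) auto

lemma wf_call_axm:
  assumes "length qs = Suc k" "\<forall>q\<in>set qs. q < width f j t"
  shows "wf_axm (call_axm (Claim b f j t) b qs g k)"
proof -
  have "qs ! i < width f j t" if "i < Suc k" for i
    using assms that by simp
  then show ?thesis
    using width_pos[of f j t] by (auto simp: wf_axm_def call_axm_def simp del: upt_Suc)
qed

lemma wf_zero_axm: "p < width g k t \<Longrightarrow> wf_axm (zero_axm (Claim b g k t) b p)"
  by (auto simp: wf_axm_def zero_axm_def)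

lemma wf_succ_axms:
  "A \<in> set (succ_axms (Claim b g k t) b p q) \<Longrightarrow> p < width g k t \<Longrightarrow> q < width g k t \<Longrightarrow> wf_axm A"
  by (auto simp: wf_axm_def succ_axms_def)

lemma wf_claim_axms: "A \<in> set (claim_axms b g k) \<Longrightarrow> wf_axm A"
proof (induction b g k rule: claim_axms.induct)
  case (1 b k)
  then show ?case by (auto intro: wf_zero_axm)
next
  case (2 b k)
  then show ?case
    by (cases "k = 1") (auto simp: Let_def elim!: wf_succ_axms, auto simp: wf_axm_def)
next
  case (3 b i k)
  then show ?case by (auto simp: Let_def wf_axm_def split: if_splits)
next
  case (4 b f gs k)
  then show ?case
    by (auto simp: Let_def simp del: upt_Suc intro!: wf_call_axm) (auto simp: wf_axm_def image_iff simp del: upt_Suc)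
next
  case (5 b f g k)
  then show ?case
    by (auto simp: Let_def numeral_2_eq_2 simp del: upt_Suc split: if_splits
      intro!: wf_call_axm intro: wf_zero_axm elim!: wf_succ_axms) (auto simp: wf_axm_def simp del: upt_Suc)
next
  case (6 b f k)
  then show ?case
    by (auto simp: Let_def numeral_2_eq_2 simp del: upt_Suc split: if_splits
      intro!: wf_call_axm intro: wf_zero_axm) (auto simp: wf_axm_def simp del: upt_Suc)
qed

lemma wf_prog_axms: "A \<in> set (prog_axms f k) \<Longrightarrow> wf_axm A"
  by (auto simp: prog_axms_def intro: wf_claim_axms)

declare upt_Suc [simp del]

lemma upt_Suc_Suc_from_1: "[1..<Suc (Suc k)] = 1 # [2..<Suc (Suc k)]"
  by (simp add: upt_rec numeral_2_eq_2)

section \<open>Soundness of claims in ordered structures\<close>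

context numbers
begin

definition ev :: "bool \<Rightarrow> (sort \<Rightarrow> 'd) \<Rightarrow> nat \<Rightarrow> nat" where
  "ev b a p = val (Sort b p) (a (Sort b p))"

definition within :: "bool \<Rightarrow> nat \<Rightarrow> (sort \<Rightarrow> 'd) \<Rightarrow> bool" where
  "within b w a \<longleftrightarrow> (\<forall>p<w. a (Sort b p) \<in> D (Sort b p))"

definition ok :: "axm \<Rightarrow> bool" where
  "ok A \<longleftrightarrow> sat D rel A \<and> asorts A \<subseteq> U"

lemma head_witness:
  assumes "ok (Ax (map (Sort b) [0..<w]) B H)" "\<forall>r\<in>set B. rel r a" "within b w a"
  shows "\<exists>(J, R)\<in>set H. \<exists>a'. (\<forall>p<w. a' (Sort b p) = a (Sort b p)) \<and>
    (\<forall>j\<in>set J. a' j \<in> D j) \<and> (\<forall>r\<in>set R. rel r a')"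
proof -
  have conv: "(\<forall>i\<in>set (map (Sort b) [0..<w]). Q i) \<longleftrightarrow> (\<forall>p<w. Q (Sort b p))" for Q by auto
  have "sat D rel (Ax (map (Sort b) [0..<w]) B H)" using assms(1) by (simp only: ok_def)
  from this[unfolded sat_def axm.sel conv, THEN spec, THEN mp, THEN mp, OF assms(3)[unfolded within_def] assms(2)]
  show ?thesis .
qed

lemma unique_head_witness:
  assumes "ok (Ax (map (Sort b) [0..<w]) B [(J, R)])" "\<forall>r\<in>set B. rel r a" "within b w a"
  obtains a' where "\<forall>p<w. a' (Sort b p) = a (Sort b p)" "\<forall>j\<in>set J. a' j \<in> D j" "\<forall>r\<in>set R. rel r a'"
  using head_witness[OF assms] by auto

lemma rel_upd: "i \<notin> set (sorts r) \<Longrightarrow> rel r (a(i := y)) \<longleftrightarrow> rel r a"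
  by (rule local_relD[OF loc]) auto

text \<open>The copied points are comparable in both directions, so they have equal values and the
  claim on the other copy is about the same numbers.\<close>

lemma call_witness:
  assumes "ok (call_axm (Claim b f j t) b qs g k)" "rel (Claim b f j t) a" "within b (width f j t) a"
    "length qs = Suc k" "\<forall>q\<in>set qs. q < width f j t"
  shows "\<exists>a'. rel (Claim (\<not> b) g k 0) a' \<and> within (\<not> b) (Suc k) a' \<and>
    ev (\<not> b) a' 0 = ev b a (hd qs) \<and> map (ev (\<not> b) a') [1..<Suc k] = map (ev b a) (tl qs)"
proof -
  let ?r = "Claim b f j t"
  have U: "Sort b p \<in> U" if "p < width f j t" for p
    using assms(1) that by (auto simp: ok_def call_axm_def asorts_def)
  have U': "Sort (\<not> b) i \<in> U" if "i < Suc k" for i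
    using assms(1) that by (auto simp: ok_def call_axm_def asorts_def)
  have "\<forall>i\<in>set (sorts ?r). a i \<in> D i" using assms(3) by (auto simp: within_def)
  then obtain a' where a': "\<forall>i\<in>set (sorts ?r). a' i = a i"
      "\<forall>j\<in>set (map (Sort (\<not> b)) [0..<Suc k]). a' j \<in> D j"
      "\<forall>r\<in>set (Claim (\<not> b) g k 0 # concat (map (\<lambda>i. same (Sort b (qs ! i)) (Sort (\<not> b) i)) [0..<Suc k])). rel r a'"
    using assms(1,2) unfolding ok_def call_axm_def sat_def axm.sel by auto
  have D': "a' (Sort (\<not> b) i) \<in> D (Sort (\<not> b) i)" if "i < Suc k" for i
    using a'(2) that by simp
  have eq: "ev (\<not> b) a' i = ev b a (qs ! i)" if i: "i < Suc k" for i
  proof -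
    have q: "qs ! i < width f j t" using assms(4,5) i by simp
    then have aq: "a' (Sort b (qs ! i)) = a (Sort b (qs ! i))" using a'(1) by simp
    have Dq: "a (Sort b (qs ! i)) \<in> D (Sort b (qs ! i))" using assms(3) q by (simp add: within_def)
    have "rel (LE (Sort b (qs ! i)) (Sort (\<not> b) i)) a'" "rel (LE (Sort (\<not> b) i) (Sort b (qs ! i))) a'"
      using a'(3) i by (auto)
    then show ?thesis
      using rel_le[OF U[OF q] U'[OF i], of a'] rel_le[OF U'[OF i] U[OF q], of a'] D'[OF i] Dq aq
      by (simp add: ev_def)
  qed
  have "map (ev (\<not> b) a') [1..<Suc k] = map (ev b a) (tl qs)"
    using assms(4) eq by (intro nth_equalityI) (auto simp: nth_tl)
  moreover have "ev (\<not> b) a' 0 = ev b a (hd qs)"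
    using eq[of 0] assms(4) by (cases qs) auto
  moreover have "rel (Claim (\<not> b) g k 0) a'" using a'(3) by simp
  ultimately show ?thesis using D' unfolding within_def by blast
qed

text \<open>A positive value would by \<open>onto\<close> have a point of value 0 below it in the
  other copy. Changing the assignment there does not touch the claim, all of whose sorts are in copy
  \<open>b\<close>.\<close>

lemma zero_value:
  assumes "ok (zero_axm (Claim b g k t) b p)" "rel (Claim b g k t) a" "within b (width g k t) a"
    "p < width g k t"
  shows "ev b a p = 0"
proof (rule ccontr)
  let ?z = "Sort (\<not> b) 0"
  assume nz: "ev b a p \<noteq> 0"
  have U: "Sort b p \<in> U" "?z \<in> U"
    using assms(1,4) by (auto simp: ok_def zero_axm_def asorts_def)
  have Dp: "a (Sort b p) \<in> D (Sort b p)" using assms(3,4) by (simp add: within_def)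
  obtain y where y: "y \<in> D ?z" "val ?z y = 0"
    using onto[OF U _ Dp, of 0] nz by (auto simp: ev_def)
  let ?a = "a(?z := y)"
  have "rel (Claim b g k t) ?a"
    using assms(2) by (subst rel_upd) auto
  moreover have "rel (LT ?z (Sort b p)) ?a"
    using rel_lt[OF U(2,1), of ?a] y Dp nz by (simp add: ev_def)
  moreover have "\<forall>i\<in>set (sorts (Claim b g k t) @ [?z]). ?a i \<in> D i"
    using assms(3) y by (auto simp: within_def)
  ultimately show False
    using assms(1)[unfolded ok_def sat_def zero_axm_def axm.sel, THEN conjunct1, THEN spec[of _ ?a]]
    by simp
qed

text \<open>The first axiom makes the value at \<open>q\<close> larger; if it skipped a number,
  \<open>onto\<close> would supply a point in between, against the second axiom.\<close>

lemma succ_value: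
  assumes "\<forall>A\<in>set (succ_axms (Claim b g k t) b p q). ok A" "rel (Claim b g k t) a"
    "within b (width g k t) a" "p < width g k t" "q < width g k t" "p \<noteq> q"
  shows "ev b a q = Suc (ev b a p)"
proof -
  let ?z = "Sort (\<not> b) 0" and ?r = "Claim b g k t"
  have U: "Sort b p \<in> U" "Sort b q \<in> U" "?z \<in> U"
    using assms(1,4,5) by (auto simp: ok_def succ_axms_def asorts_def)
  have Dp: "a (Sort b p) \<in> D (Sort b p)" "a (Sort b q) \<in> D (Sort b q)"
    using assms(3-5) by (simp_all add: within_def)
  have Dr: "\<forall>i\<in>set (sorts ?r). a i \<in> D i" using assms(3) by (auto simp: within_def)
  have ok: "ok (Ax (map (Sort b) [0..<width g k t]) [?r] [([], [LT (Sort b p) (Sort b q)])])"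
    "sat D rel (Ax (sorts ?r @ [?z]) [?r, LT (Sort b p) ?z, LT ?z (Sort b q)] [])"
    using assms(1) by (simp_all add: ok_def succ_axms_def)
  from head_witness[OF ok(1) _ assms(3)] assms(2) obtain a' where
    "\<forall>i<width g k t. a' (Sort b i) = a (Sort b i)" "rel (LT (Sort b p) (Sort b q)) a'" by auto
  then have less: "ev b a p < ev b a q"
    using rel_lt[OF U(1,2), of a'] Dp assms(4-6) by (simp add: ev_def)
  show ?thesis
  proof (rule ccontr)
    assume "ev b a q \<noteq> Suc (ev b a p)"
    then have gap: "Suc (ev b a p) < ev b a q" using less by simp
    obtain y where y: "y \<in> D ?z" "val ?z y = Suc (ev b a p)"
      using onto[OF U(2,3) _ Dp(2)] gap by (auto simp: ev_def)
    let ?a = "a(?z := y)"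
    have "rel ?r ?a" using assms(2) by (subst rel_upd) auto
    moreover have "rel (LT (Sort b p) ?z) ?a" "rel (LT ?z (Sort b q)) ?a"
      using rel_lt[OF U(1,3), of ?a] rel_lt[OF U(3,2), of ?a] y Dp gap by (simp_all add: ev_def)
    moreover have "\<forall>i\<in>set (sorts ?r @ [?z]). ?a i \<in> D i" using Dr y by auto
    ultimately show False
      using ok(2)[unfolded sat_def axm.sel, THEN spec[of _ ?a]] by simp
  qed
qed

lemma ev_cong: "\<forall>p<w. a' (Sort b p) = a (Sort b p) \<Longrightarrow> p < w \<Longrightarrow> ev b a' p = ev b a p"
  by (simp add: ev_def)

lemma ev_map_cong:
  "\<forall>p<w. a' (Sort b p) = a (Sort b p) \<Longrightarrow> \<forall>p\<in>set ps. p < w \<Longrightarrow> map (ev b a') ps = map (ev b a) ps"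
  by (simp add: ev_def)

definition sound :: "recf \<Rightarrow> nat \<Rightarrow> bool" where
  "sound g k \<longleftrightarrow> (\<forall>b a. rel (Claim b g k 0) a \<longrightarrow> within b (Suc k) a \<longrightarrow>
    computes g (map (ev b a) [1..<Suc k]) (ev b a 0))"

lemma sound_call:
  assumes "ok (call_axm (Claim b f j t) b (q # qs) g k)" "rel (Claim b f j t) a"
    "within b (width f j t) a" "length qs = k" "\<forall>q\<in>set (q # qs). q < width f j t" "sound g k"
  shows "computes g (map (ev b a) qs) (ev b a q)"
proof -
  obtain a' where a': "rel (Claim (\<not> b) g k 0) a'" "within (\<not> b) (Suc k) a'"
    "ev (\<not> b) a' 0 = ev b a q" "map (ev (\<not> b) a') [1..<Suc k] = map (ev b a) qs"
    using call_witness[OF assms(1-3) _ assms(5)] assms(4) by auto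
  then show ?thesis using assms(6) unfolding sound_def by metis
qed

lemma soundI:
  assumes "\<And>b a. rel (Claim b g k 0) a \<Longrightarrow> within b (Suc k) a \<Longrightarrow>
    computes g (map (ev b a) [1..<Suc k]) (ev b a 0)"
  shows "sound g k"
  using assms unfolding sound_def by blast

lemma sound_Comp:
  assumes ok: "\<And>b A. A \<in> set (claim_axms b (Comp f gs) k) \<Longrightarrow> ok A"
    and f: "sound f (length gs)" and gs: "\<And>g. g \<in> set gs \<Longrightarrow> sound g k"
  shows "sound (Comp f gs) k"
proof (rule soundI)
  fix b a
  let ?F = "Claim b (Comp f gs) k 0" and ?H = "Claim b (Comp f gs) k 1" and ?m = "length gs"
  assume F: "rel ?F a" and a: "within b (Suc k) a"
  have "ok (Ax (map (Sort b) [0..<Suc k]) [?F] [(map (Sort b) [Suc k..<Suc k + ?m], [?H])])"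
    by (rule ok[of _ b]) (simp add: Let_def)
  from head_witness[OF this _ a] F obtain a' where a': "\<forall>p<Suc k. a' (Sort b p) = a (Sort b p)"
      "\<forall>j\<in>set (map (Sort b) [Suc k..<Suc k + ?m]). a' j \<in> D j" "rel ?H a'" by auto
  have w: "within b (width (Comp f gs) k 1) a'"
    unfolding within_def
  proof (intro allI impI)
    fix p assume "p < width (Comp f gs) k 1"
    then have "p < Suc k \<or> Sort b p \<in> set (map (Sort b) [Suc k..<Suc k + ?m])" by auto
    then show "a' (Sort b p) \<in> D (Sort b p)"
      using a a'(1,2) unfolding within_def by metis
  qed
  have "computes f (map (ev b a') [Suc k..<Suc k + ?m]) (ev b a' 0)"
    by (rule sound_call[OF ok[of _ b] a'(3) w _ _ f]) (auto simp: Let_def)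
  moreover have "computes (gs ! j) (map (ev b a') [1..<Suc k]) (ev b a' (Suc k + j))" if "j < ?m" for j
    using that gs by (intro sound_call[OF ok[of _ b] a'(3) w]) (auto simp: Let_def)
  ultimately have "computes (Comp f gs) (map (ev b a') [1..<Suc k]) (ev b a' 0)"
    by (intro computes.Comp[where ys = "map (ev b a') [Suc k..<Suc k + ?m]"])
      (auto simp: list_all2_conv_all_nth)
  moreover have "map (ev b a') [1..<Suc k] = map (ev b a) [1..<Suc k]"
    by (rule ev_map_cong[OF a'(1)]) simp
  ultimately show "computes (Comp f gs) (map (ev b a) [1..<Suc k]) (ev b a 0)"
    using ev_cong[OF a'(1), of 0] by (simp del: map_eq_conv)
qed

text \<open>Induction on the value of the recursion argument, for both copies at once because the
  recursive claim lives on the other copy. The successor axiom makes the argument drop, so claims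
  cannot support each other in a circle.\<close>

lemma sound_PrimRec:
  assumes ok: "\<And>b A. A \<in> set (claim_axms b (PrimRec f g) k) \<Longrightarrow> ok A"
    and f: "sound f (k - 1)" and g: "sound g (Suc k)"
  shows "sound (PrimRec f g) k"
proof (rule soundI)
  fix b a
  assume "rel (Claim b (PrimRec f g) k 0) a" "within b (Suc k) a"
  then show "computes (PrimRec f g) (map (ev b a) [1..<Suc k]) (ev b a 0)"
  proof (induction "ev b a 1" arbitrary: b a rule: less_induct)
    case less
    let ?F = "Claim b (PrimRec f g) k 0" and ?H = "Claim b (PrimRec f g) k 1"
      and ?H' = "Claim b (PrimRec f g) k 2"
    show ?case
    proof (cases k)
      case 0
      then have "ok (Ax (map (Sort b) [0..<Suc k]) [?F] [])"
        by (intro ok[of _ b]) (simp add: Let_def)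
      from head_witness[OF this _ less.prems(2)] less.prems(1) show ?thesis by simp
    next
      case (Suc m)
      have "ok (Ax (map (Sort b) [0..<Suc k]) [?F]
          [([], [?H]), ([Sort b (k + 1), Sort b (k + 2)], [?H'])])"
        using Suc by (intro ok[of _ b]) (simp add: Let_def)
      from head_witness[OF this _ less.prems(2)] less.prems(1) obtain a' where
        a': "\<forall>p<Suc k. a' (Sort b p) = a (Sort b p)" and
        cases: "rel ?H a' \<or> a' (Sort b (k + 1)) \<in> D (Sort b (k + 1)) \<and>
          a' (Sort b (k + 2)) \<in> D (Sort b (k + 2)) \<and> rel ?H' a'" by auto
      have eqs: "map (ev b a') [1..<Suc k] = map (ev b a) [1..<Suc k]" "ev b a' 0 = ev b a 0"
          "ev b a' 1 = ev b a 1"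
        using ev_map_cong[OF a', of "[1..<Suc k]"] ev_cong[OF a'] Suc by auto
      have args: "map (ev b a') [1..<Suc k] = ev b a' 1 # map (ev b a') [2..<Suc k]"
        unfolding Suc upt_Suc_Suc_from_1 by simp
      from cases have "computes (PrimRec f g) (map (ev b a') [1..<Suc k]) (ev b a' 0)"
      proof
        assume H: "rel ?H a'"
        have w: "within b (width (PrimRec f g) k 1) a'"
          using less.prems(2) a' by (simp add: within_def)
        have "ev b a' 1 = 0"
          using Suc by (intro zero_value[OF ok[of _ b] H w]) (auto simp: Let_def)
        moreover have "computes f (map (ev b a') [2..<Suc k]) (ev b a' 0)"
          using Suc by (intro sound_call[OF ok[of _ b] H w _ _ f]) (auto simp: Let_def)
        ultimately show ?thesis unfolding args by (auto intro: computes.PrimRec_0)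
      next
        assume H: "a' (Sort b (k + 1)) \<in> D (Sort b (k + 1)) \<and>
          a' (Sort b (k + 2)) \<in> D (Sort b (k + 2)) \<and> rel ?H' a'"
        have w: "within b (width (PrimRec f g) k 2) a'"
          unfolding within_def
        proof (intro allI impI)
          fix p assume "p < width (PrimRec f g) k 2"
          then have "p < Suc k \<or> p = k + 1 \<or> p = k + 2" by (auto simp: numeral_2_eq_2)
          then show "a' (Sort b p) \<in> D (Sort b p)"
            using less.prems(2) a' H unfolding within_def by metis
        qed
        have H': "rel ?H' a'" using H by blast
        have s: "ev b a' 1 = Suc (ev b a' (k + 1))"
          using Suc by (intro succ_value[OF _ H' w] ballI ok[of _ b]) (auto simp: Let_def numeral_2_eq_2)
        have "ok (call_axm ?H' b ((k + 2) # (k + 1) # [2..<Suc k]) (PrimRec f g) k)"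
          using Suc by (intro ok[of _ b]) (auto simp: Let_def)
        from call_witness[OF this H' w] Suc obtain a'' where a'':
          "rel (Claim (\<not> b) (PrimRec f g) k 0) a''" "within (\<not> b) (Suc k) a''"
          "ev (\<not> b) a'' 0 = ev b a' (k + 2)"
          "map (ev (\<not> b) a'') [1..<Suc k] = map (ev b a') ((k + 1) # [2..<Suc k])"
          by (auto simp: numeral_2_eq_2)
        have "ev (\<not> b) a'' 1 = ev b a' (k + 1)"
          using arg_cong[OF a''(4), of hd] unfolding Suc upt_Suc_Suc_from_1 by simp
        then have "computes (PrimRec f g) (map (ev (\<not> b) a'') [1..<Suc k]) (ev (\<not> b) a'' 0)"
          using s eqs(3) by (intro less.hyps a'') simp
        then have rec: "computes (PrimRec f g) (ev b a' (k + 1) # map (ev b a') [2..<Suc k]) (ev b a' (k + 2))"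
          unfolding a''(3,4) by simp
        have "computes g (map (ev b a') ((k + 1) # (k + 2) # [2..<Suc k])) (ev b a' 0)"
          using Suc by (intro sound_call[OF ok[of _ b] H' w _ _ g])
            (auto simp: Let_def numeral_2_eq_2)
        then show ?thesis
          unfolding args s using rec by (auto intro: computes.PrimRec_Suc)
      qed
      then show ?thesis unfolding eqs .
    qed
  qed
qed

text \<open>By \<open>onto\<close> every \<open>m\<close> below the claimed minimum is denoted by a
  point of the sort at position \<open>k + 1\<close>, so the universally quantified axiom really
  tests all earlier arguments.\<close>

lemma sound_Mu:
  assumes ok: "\<And>b A. A \<in> set (claim_axms b (Mu f) k) \<Longrightarrow> ok A" and f: "sound f (Suc k)"
  shows "sound (Mu f) k"
proof (rule soundI)
  fix b a
  let ?F = "Claim b (Mu f) k 0" and ?H = "Claim b (Mu f) k 1" and ?H' = "Claim b (Mu f) k 2"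
  assume F: "rel ?F a" and a: "within b (Suc k) a"
  have okF: "ok (Ax (map (Sort b) [0..<Suc k]) [?F] [([Sort b (k + 1)], [?H])])"
    by (rule ok[of _ b]) (simp add: Let_def)
  from head_witness[OF this _ a] F obtain a' where a': "\<forall>p<Suc k. a' (Sort b p) = a (Sort b p)"
      "a' (Sort b (k + 1)) \<in> D (Sort b (k + 1))" "rel ?H a'" by auto
  have U: "Sort b 0 \<in> U" "Sort b (k + 1) \<in> U"
    using okF by (auto simp: ok_def asorts_def)
  show "computes (Mu f) (map (ev b a) [1..<Suc k]) (ev b a 0)"
  proof (rule computes.Mu)
    have w: "within b (width (Mu f) k 1) a'"
      using a a'(1,2) by (auto simp: within_def less_Suc_eq)
    have "ev b a' (k + 1) = 0"
      by (intro zero_value[OF ok[of _ b] a'(3) w]) (auto simp: Let_def)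
    moreover have "computes f (map (ev b a') (0 # [1..<Suc k])) (ev b a' (k + 1))"
      by (intro sound_call[OF ok[of _ b] a'(3) w _ _ f]) (auto simp: Let_def)
    moreover have "map (ev b a') [1..<Suc k] = map (ev b a) [1..<Suc k]"
      by (rule ev_map_cong[OF a'(1)]) simp
    ultimately show "computes f (ev b a 0 # map (ev b a) [1..<Suc k]) 0"
      using ev_cong[OF a'(1), of 0] by (simp del: map_eq_conv)
  next
    show "\<forall>m<ev b a 0. \<exists>n. computes f (m # map (ev b a) [1..<Suc k]) (Suc n)"
    proof (intro allI impI)
      fix m assume m: "m < ev b a 0"
      have D0: "a (Sort b 0) \<in> D (Sort b 0)" using a by (simp add: within_def)
      obtain y where y: "y \<in> D (Sort b (k + 1))" "val (Sort b (k + 1)) y = m"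
        using onto[OF U _ D0] m by (auto simp: ev_def)
      let ?a = "a(Sort b (k + 1) := y)"
      have okM: "ok (Ax (map (Sort b) [0..<k + 2]) [?F, LT (Sort b (k + 1)) (Sort b 0)]
          [([Sort b (k + 2), Sort (\<not> b) 0], [?H', LT (Sort (\<not> b) 0) (Sort b (k + 2))])])"
        by (intro ok[of _ b]) (simp add: Let_def upt_Suc[of 0 "Suc k"])
      have m1: "rel ?F ?a" using F by (subst rel_upd) auto
      have m2: "rel (LT (Sort b (k + 1)) (Sort b 0)) ?a"
        using rel_lt[OF U(2,1), of ?a] y D0 m by (simp add: ev_def)
      have wa: "within b (k + 2) ?a"
        using a y by (auto simp: within_def less_Suc_eq)
      have "\<forall>r\<in>set [?F, LT (Sort b (k + 1)) (Sort b 0)]. rel r ?a" using m1 m2 by simp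
      then obtain a' where a'1: "\<forall>p<k + 2. a' (Sort b p) = ?a (Sort b p)"
        and "\<forall>j\<in>set [Sort b (k + 2), Sort (\<not> b) 0]. a' j \<in> D j"
          "\<forall>r\<in>set [?H', LT (Sort (\<not> b) 0) (Sort b (k + 2))]. rel r a'"
        by (rule unique_head_witness[OF okM _ wa])
      then have a': "a' (Sort b (k + 2)) \<in> D (Sort b (k + 2))" "a' (Sort (\<not> b) 0) \<in> D (Sort (\<not> b) 0)"
        "rel ?H' a'" "rel (LT (Sort (\<not> b) 0) (Sort b (k + 2))) a'" by simp_all
      have w: "within b (width (Mu f) k 2) a'"
        unfolding within_def
      proof (intro allI impI)
        fix p assume "p < width (Mu f) k 2"
        then have "p < k + 2 \<or> p = k + 2" by (auto simp: numeral_2_eq_2)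
        then show "a' (Sort b p) \<in> D (Sort b p)"
          using wa a'1 a'(1) unfolding within_def by metis
      qed
      have "computes f (map (ev b a') ((k + 1) # [1..<Suc k])) (ev b a' (k + 2))"
        by (intro sound_call[OF ok[of _ b] a'(3) w _ _ f])
          (auto simp: Let_def numeral_2_eq_2)
      moreover have "map (ev b a') [1..<Suc k] = map (ev b a) [1..<Suc k]"
        using a'1 by (auto simp: ev_def)
      moreover have "ev b a' (k + 1) = m" using a'1 y by (simp add: ev_def)
      \<comment> \<open>Positivity of the value is witnessed by a point strictly below it.\<close>
      moreover have "Sort b (k + 2) \<in> U" "Sort (\<not> b) 0 \<in> U"
        using okM by (auto simp: ok_def asorts_def)
      then have "ev b a' (k + 2) > 0"
        using rel_lt[of "Sort (\<not> b) 0" "Sort b (k + 2)" a'] a'(1,2,4) by (simp add: ev_def)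
      ultimately show "\<exists>n. computes f (m # map (ev b a) [1..<Suc k]) (Suc n)"
        by (metis Suc_pred list.simps(9))
    qed
  qed
qed

lemma sound_claims:
  "(\<And>g j b A. (g, j) \<in> set (subs f k) \<Longrightarrow> A \<in> set (claim_axms b g j) \<Longrightarrow> ok A) \<Longrightarrow> sound f k"
proof (induction f arbitrary: k)
  case Zero
  show ?case
  proof (rule soundI)
    fix b a assume "rel (Claim b Zero k 0) a" "within b (Suc k) a"
    moreover have "ok (zero_axm (Claim b Zero k 0) b 0)" by (rule Zero[of Zero k _ b]) simp_all
    ultimately have "ev b a 0 = 0" by (intro zero_value) auto
    then show "computes Zero (map (ev b a) [1..<Suc k]) (ev b a 0)" using computes.Zero by simp
  qed
next
  case Succ
  show ?case
  proof (rule soundI)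
    fix b a assume F: "rel (Claim b Succ k 0) a" "within b (Suc k) a"
    show "computes Succ (map (ev b a) [1..<Suc k]) (ev b a 0)"
    proof (cases "k = 1")
      case True
      then have "ev b a 0 = Suc (ev b a 1)"
        using F Succ[of Succ k _ b] by (intro succ_value[of b Succ k 0]) (auto simp: Let_def)
      then show ?thesis using True computes.Succ by (simp add: upt_Suc)
    next
      case False
      then have "ok (Ax (map (Sort b) [0..<Suc k]) [Claim b Succ k 0] [])"
        by (intro Succ[of Succ k _ b]) (simp_all add: Let_def)
      from head_witness[OF this _ F(2)] F(1) show ?thesis by simp
    qed
  qed
next
  case (Proj i)
  show ?case
  proof (rule soundI)
    fix b a assume F: "rel (Claim b (Proj i) k 0) a" "within b (Suc k) a"
    show "computes (Proj i) (map (ev b a) [1..<Suc k]) (ev b a 0)"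
    proof (cases "i < k")
      case True
      have ok: "ok (Ax (map (Sort b) [0..<Suc k]) [Claim b (Proj i) k 0]
          [([], same (Sort b 0) (Sort b (Suc i)))])"
        using True by (intro Proj[of "Proj i" k _ b]) (simp_all add: Let_def)
      then have U: "Sort b 0 \<in> U" "Sort b (Suc i) \<in> U"
        using True by (auto simp: ok_def asorts_def)
      have D: "a (Sort b 0) \<in> D (Sort b 0)" "a (Sort b (Suc i)) \<in> D (Sort b (Suc i))"
        using F(2) True by (simp_all add: within_def)
      from head_witness[OF ok _ F(2)] F(1) obtain a' where "\<forall>p<Suc k. a' (Sort b p) = a (Sort b p)"
        "rel (LE (Sort b 0) (Sort b (Suc i))) a'" "rel (LE (Sort b (Suc i)) (Sort b 0)) a'" by auto
      then have "ev b a 0 = ev b a (Suc i)"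
        using rel_le[OF U, of a'] rel_le[OF U(2,1), of a'] D True by (simp add: ev_def)
      then show ?thesis using True computes.Proj[of i "map (ev b a) [1..<Suc k]"]
        by simp
    next
      case False
      then have "ok (Ax (map (Sort b) [0..<Suc k]) [Claim b (Proj i) k 0] [])"
        by (intro Proj[of "Proj i" k _ b]) (simp_all add: Let_def)
      from head_witness[OF this _ F(2)] F(1) show ?thesis by simp
    qed
  qed
next
  case (Comp f gs)
  show ?case
  proof (rule sound_Comp)
    show "ok A" if "A \<in> set (claim_axms b (Comp f gs) k)" for b A
      by (rule Comp.prems[OF _ that]) simp
    show "sound f (length gs)" by (rule Comp.IH(1), rule Comp.prems) auto
    show "sound g k" if "g \<in> set gs" for g
      by (rule Comp.IH(2)[OF that], rule Comp.prems) (use that in auto)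
  qed
next
  case (PrimRec f g)
  show ?case
  proof (rule sound_PrimRec)
    show "ok A" if "A \<in> set (claim_axms b (PrimRec f g) k)" for b A
      by (rule PrimRec.prems[OF _ that]) simp
    show "sound f (k - 1)" by (rule PrimRec.IH(1), rule PrimRec.prems) auto
    show "sound g (Suc k)" by (rule PrimRec.IH(2), rule PrimRec.prems) auto
  qed
next
  case (Mu f)
  show ?case
  proof (rule sound_Mu)
    show "ok A" if "A \<in> set (claim_axms b (Mu f) k)" for b A
      by (rule Mu.prems[OF _ that]) simp
    show "sound f (Suc k)" by (rule Mu.IH, rule Mu.prems) auto
  qed
qed

end

section \<open>The standard structure\<close>

text \<open>The intended truth of \<open>Claim\<close> on the values \<open>e\<close> of its
  positions. Evaluation is bounded so that the intermediate values of a true claim exist in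
  \<open>{..N}\<close>.\<close>

definition meaning :: "nat \<Rightarrow> recf \<Rightarrow> nat \<Rightarrow> nat \<Rightarrow> (nat \<Rightarrow> nat) \<Rightarrow> bool" where
  "meaning N h k t e = (if t = 0 then bcomp N h (map e [1..<Suc k]) (e 0) else
    (case h of
      Comp f gs \<Rightarrow> t = 1 \<and> bcomp N f (map e [Suc k..<Suc k + length gs]) (e 0) \<and>
        (\<forall>j<length gs. bcomp N (gs ! j) (map e [1..<Suc k]) (e (Suc k + j)))
    | PrimRec f g \<Rightarrow> k > 0 \<and> (t = 1 \<and> e 1 = 0 \<and> bcomp N f (map e [2..<Suc k]) (e 0) \<or>
        t = 2 \<and> e 1 = Suc (e (k + 1)) \<and>
          bcomp N h (map e ((k + 1) # [2..<Suc k])) (e (k + 2)) \<and>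
          bcomp N g (map e ((k + 1) # (k + 2) # [2..<Suc k])) (e 0))
    | Mu f \<Rightarrow> t = 1 \<and> e (k + 1) = 0 \<and> bcomp N f (map e (0 # [1..<Suc k])) (e (k + 1)) \<or>
        t = 2 \<and> bcomp N f (map e ((k + 1) # [1..<Suc k])) (e (k + 2))
    | _ \<Rightarrow> False))"

lemma meaning_cong:
  assumes "\<And>p. p < width h k t \<Longrightarrow> e p = e' p"
  shows "meaning N h k t e \<longleftrightarrow> meaning N h k t e'"
proof -
  have m: "map e ps = map e' ps" if "\<forall>p\<in>set ps. p < width h k t" for ps
    using that assms by simp
  have 0: "e 0 = e' 0" using assms width_pos by blast
  show ?thesis
  proof (cases "t = 0")
    case True
    then show ?thesis using m[of "[1..<Suc k]"] 0 by (simp add: meaning_def del: map_eq_conv)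
  next
    case t: False
    show ?thesis
    proof (cases h)
      case (Comp f gs)
      show ?thesis
      proof (cases "t = 1")
        case True
        have "e (Suc k + j) = e' (Suc k + j)" if "j < length gs" for j
          using that by (intro assms) (simp add: Comp True)
        then show ?thesis
          using m[of "[1..<Suc k]"] m[of "[Suc k..<Suc k + length gs]"] 0
          by (simp add: meaning_def Comp True del: map_eq_conv)
      qed (simp add: meaning_def t Comp)
    next
      case (PrimRec f g)
      consider "t = 1" "k > 0" | "t = 2" "k > 0" | "k = 0 \<or> t \<noteq> 1 \<and> t \<noteq> 2" by linarith
      then show ?thesis
      proof cases
        case 1
        then show ?thesis
          using m[of "[2..<Suc k]"] 0 assms[of 1] by (simp add: meaning_def PrimRec del: map_eq_conv)
      next
        case 2
        then show ?thesis
          using m[of "[2..<Suc k]"] 0 assms[of 1] assms[of "k + 1"] assms[of "k + 2"]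
          by (simp add: meaning_def PrimRec numeral_2_eq_2 del: map_eq_conv)
      qed (auto simp: meaning_def t PrimRec)
    next
      case (Mu f)
      consider "t = 1" | "t = 2" | "t \<noteq> 1 \<and> t \<noteq> 2" by linarith
      then show ?thesis
      proof cases
        case 1
        then show ?thesis
          using m[of "[1..<Suc k]"] 0 assms[of "k + 1"] by (simp add: meaning_def Mu del: map_eq_conv)
      next
        case 2
        then show ?thesis
          using m[of "[1..<Suc k]"] 0 assms[of "k + 1"] assms[of "k + 2"]
          by (simp add: meaning_def Mu numeral_2_eq_2 del: map_eq_conv)
      qed (auto simp: meaning_def t Mu)
    qed (simp_all add: meaning_def t)
  qed
qed

fun std_rel :: "nat \<Rightarrow> nat \<Rightarrow> rsym \<Rightarrow> (sort \<Rightarrow> nat) \<Rightarrow> bool" where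
  "std_rel N n (LT i j) a \<longleftrightarrow> a i < a j"
| "std_rel N n (LE i j) a \<longleftrightarrow> a i \<le> a j"
| "std_rel N n Inp a \<longleftrightarrow> a (Sort False 1) = n"
| "std_rel N n (Num b m) a \<longleftrightarrow> a (Sort b 1) = m"
| "std_rel N n (Claim b g k t) a \<longleftrightarrow> meaning N g k t (\<lambda>p. a (Sort b p))"

lemma local_std_rel: "local_rel (std_rel N n)"
  unfolding local_rel_def
proof (intro allI impI)
  fix r and a a' :: "sort \<Rightarrow> nat"
  assume *: "\<forall>i\<in>set (sorts r). a i = a' i" and r: "std_rel N n r a"
  show "std_rel N n r a'"
  proof (cases r)
    case (Claim b g k t)
    have "meaning N g k t (\<lambda>p. a (Sort b p)) \<longleftrightarrow> meaning N g k t (\<lambda>p. a' (Sort b p))"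
      using * unfolding Claim by (intro meaning_cong) simp
    then show ?thesis using r Claim by simp
  qed (use * r in simp_all)
qed

abbreviation std_sat :: "nat \<Rightarrow> nat \<Rightarrow> axm \<Rightarrow> bool" where
  "std_sat N n \<equiv> sat (\<lambda>_. {..N}) (std_rel N n)"

lemma sat_plain:
  assumes "\<And>a. \<forall>r\<in>set B. rel r a \<Longrightarrow> \<forall>r\<in>set R. rel r a"
  shows "sat D rel (Ax I B [([], R)])"
  using assms unfolding sat_def by auto

lemma std_base_axms: "A \<in> set (base_axms S) \<Longrightarrow> std_sat N n A"
  unfolding set_base_axms
proof (elim bexE conjE disjE)
  fix i j
  assume "A = Ax [i, j] [] [([], [LT i j]), ([], [LE j i])]"
  then show ?thesis by (simp add: sat_def) (metis not_le)
next
  fix i j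
  assume "i \<noteq> j" "A = Ax [i] [] [([j], [LE i j, LE j i])]"
  then show ?thesis
    by (auto simp: sat_def intro!: exI[of _ "_(j := _ i)"])
qed (auto simp: sat_def)

lemma std_call_axm:
  assumes "length qs = k" "\<forall>q\<in>set (q # qs). q < width f j t"
    and "\<And>e. meaning N f j t e \<Longrightarrow> bcomp N g (map e qs) (e q)"
  shows "std_sat N n (call_axm (Claim b f j t) b (q # qs) g k)"
  unfolding sat_def call_axm_def axm.sel
proof (intro allI impI)
  let ?qs = "q # qs"
  fix a :: "sort \<Rightarrow> nat"
  assume a: "\<forall>i\<in>set (sorts (Claim b f j t)). a i \<in> {..N}"
    "\<forall>r\<in>set [Claim b f j t]. std_rel N n r a"
  \<comment> \<open>The other copy receives the values to be passed on; the default 0 concerns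
    positions above \<open>k\<close>, which the axiom does not mention.\<close>
  define a' where "a' s = (case s of Sort c i \<Rightarrow>
    if c = b then a s else if i < Suc k then a (Sort b (?qs ! i)) else 0)" for s
  have a'b: "a' (Sort b p) = a (Sort b p)" for p by (simp add: a'_def)
  have a'n: "a' (Sort (\<not> b) i) = a (Sort b (?qs ! i))" if "i < Suc k" for i
    using that by (simp add: a'_def)
  have q: "?qs ! i < width f j t" if "i < Suc k" for i
  proof -
    have "?qs ! i \<in> set ?qs" using assms(1) that by (intro nth_mem) simp
    then show ?thesis using assms(2) by blast
  qed
  have "map (\<lambda>p. a' (Sort (\<not> b) p)) [1..<Suc k] = map (\<lambda>p. a (Sort b p)) qs"
    using assms(1) a'n by (intro nth_equalityI) simp_all
  moreover have "bcomp N g (map (\<lambda>p. a (Sort b p)) qs) (a (Sort b q))"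
    using a(2) by (intro assms(3)) simp
  ultimately have "std_rel N n (Claim (\<not> b) g k 0) a'"
    using a'n[of 0] by (simp add: meaning_def)
  then show "\<exists>(J, R)\<in>set [(map (Sort (\<not> b)) [0..<Suc k], Claim (\<not> b) g k 0 #
      concat (map (\<lambda>i. same (Sort b (?qs ! i)) (Sort (\<not> b) i)) [0..<Suc k]))].
      \<exists>a'. (\<forall>i\<in>set (sorts (Claim b f j t)). a' i = a i) \<and> (\<forall>j\<in>set J. a' j \<in> {..N}) \<and>
        (\<forall>r\<in>set R. std_rel N n r a')"
    using a(1) a'b a'n q by (auto intro!: exI[of _ a'])
qed

lemma std_zero_axm:
  assumes "\<And>e. meaning N f j t e \<Longrightarrow> e p = 0"
  shows "std_sat N n (zero_axm (Claim b f j t) b p)"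
proof -
  have v: "a (Sort b p) = 0" if "std_rel N n (Claim b f j t) a" for a
    using assms[of "\<lambda>p. a (Sort b p)"] that by simp
  then show ?thesis by (auto simp: sat_def zero_axm_def simp del: std_rel.simps(5) dest!: v)
qed

lemma std_succ_axms:
  assumes "\<And>e. meaning N f j t e \<Longrightarrow> e q = Suc (e p)" "A \<in> set (succ_axms (Claim b f j t) b p q)"
  shows "std_sat N n A"
proof -
  have v: "a (Sort b q) = Suc (a (Sort b p))" if "std_rel N n (Claim b f j t) a" for a
    using assms(1)[of "\<lambda>p. a (Sort b p)"] that by simp
  then show ?thesis
    using assms(2) unfolding succ_axms_def
    by (auto intro!: sat_plain simp del: std_rel.simps(5) dest!: v)
      (auto simp: sat_def simp del: std_rel.simps(5) dest!: v)
qed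

lemma std_absurd:
  assumes "\<And>e. \<not> meaning N f j t e"
  shows "std_sat N n (Ax I [Claim b f j t] [])"
  using assms by (simp add: sat_def)

text \<open>Axioms that unfold a claim within one copy reduce to a statement about numbers: an
  alternative consists of the new positions \<open>J\<close> and the tags \<open>R\<close> of the
  claims about them.\<close>

lemma std_extend:
  assumes "\<And>e. meaning N f k 0 e \<Longrightarrow> \<forall>p<Suc k. e p \<le> N \<Longrightarrow> \<exists>(J, R)\<in>set H. \<exists>e'. (\<forall>p<Suc k. e' p = e p) \<and>
    (\<forall>p\<in>set J. e' p \<le> N) \<and> (\<forall>t\<in>set R. meaning N f k t e')"
  shows "std_sat N n (Ax (map (Sort b) [0..<Suc k]) [Claim b f k 0]
    (map (\<lambda>(J, R). (map (Sort b) J, map (Claim b f k) R)) H))"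
  unfolding sat_def axm.sel
proof (intro allI impI)
  fix a :: "sort \<Rightarrow> nat"
  assume a: "\<forall>i\<in>set (map (Sort b) [0..<Suc k]). a i \<in> {..N}"
    "\<forall>r\<in>set [Claim b f k 0]. std_rel N n r a"
  let ?e = "\<lambda>p. a (Sort b p)"
  obtain J R e' where e': "(J, R) \<in> set H" "\<forall>p<Suc k. e' p = ?e p" "\<forall>p\<in>set J. e' p \<le> N"
      "\<forall>t\<in>set R. meaning N f k t e'"
    using assms[of ?e] a by fastforce
  define a' where "a' s = (case s of Sort c p \<Rightarrow> if c = b then e' p else a s)" for s
  have "\<forall>i\<in>set (map (Sort b) [0..<Suc k]). a' i = a i" "\<forall>j\<in>set (map (Sort b) J). a' j \<in> {..N}"
    "\<forall>r\<in>set (map (Claim b f k) R). std_rel N n r a'"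
    using e' by (auto simp: a'_def)
  then show "\<exists>(J, R)\<in>set (map (\<lambda>(J, R). (map (Sort b) J, map (Claim b f k) R)) H).
      \<exists>a'. (\<forall>i\<in>set (map (Sort b) [0..<Suc k]). a' i = a i) \<and> (\<forall>j\<in>set J. a' j \<in> {..N}) \<and>
        (\<forall>r\<in>set R. std_rel N n r a')"
    using e'(1) by (intro bexI[of _ "(map (Sort b) J, map (Claim b f k) R)"]) (auto intro!: exI[of _ a'])
qed

section \<open>Program axioms in the standard structure\<close>

inductive_cases bcomp_ZeroE: "bcomp N Zero xs y"
inductive_cases bcomp_SuccE: "bcomp N Succ xs y"
inductive_cases bcomp_ProjE: "bcomp N (Proj i) xs y"
inductive_cases bcomp_CompE: "bcomp N (Comp f gs) xs y"
inductive_cases bcomp_PrimRecE: "bcomp N (PrimRec f g) xs y"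
inductive_cases bcomp_MuE: "bcomp N (Mu f) xs y"

lemma std_Comp:
  assumes "A \<in> set (claim_axms b (Comp f gs) k)"
  shows "std_sat N n A"
proof -
  let ?m = "length gs"
  have "std_sat N n (Ax (map (Sort b) [0..<Suc k]) [Claim b (Comp f gs) k 0]
    (map (\<lambda>(J, R). (map (Sort b) J, map (Claim b (Comp f gs) k) R)) [([Suc k..<Suc k + ?m], [1])]))"
  proof (rule std_extend)
    fix e assume "meaning N (Comp f gs) k 0 e"
    then obtain ys where ys: "list_all2 (\<lambda>g y. bcomp N g (map e [1..<Suc k]) y) gs ys"
        "\<forall>y\<in>set ys. y \<le> N" "bcomp N f ys (e 0)"
      by (auto simp: meaning_def elim: bcomp_CompE)
    define e' where "e' p = (if p < Suc k then e p else ys ! (p - Suc k))" for p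
    have len: "length ys = ?m" using ys(1) list_all2_lengthD by metis
    have "map e' [Suc k..<Suc k + ?m] = ys"
      using len by (intro nth_equalityI) (simp_all add: e'_def)
    moreover have "map e' [1..<Suc k] = map e [1..<Suc k]" by (simp add: e'_def)
    ultimately have "meaning N (Comp f gs) k 1 e'"
      using ys by (simp add: meaning_def e'_def list_all2_conv_all_nth del: map_eq_conv)
    moreover have "\<forall>p\<in>set [Suc k..<Suc k + ?m]. e' p \<le> N"
      using ys(2) len by (auto simp: e'_def)
    ultimately show "\<exists>(J, R)\<in>set [([Suc k..<Suc k + ?m], [1])]. \<exists>e'. (\<forall>p<Suc k. e' p = e p) \<and>
        (\<forall>p\<in>set J. e' p \<le> N) \<and> (\<forall>t\<in>set R. meaning N (Comp f gs) k t e')"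
      by (auto simp: e'_def intro!: exI[of _ e'])
  qed
  moreover have "std_sat N n (call_axm (Claim b (Comp f gs) k 1) b (0 # [Suc k..<Suc k + ?m]) f ?m)"
    by (rule std_call_axm) (auto simp: meaning_def)
  moreover have "std_sat N n (call_axm (Claim b (Comp f gs) k 1) b ((Suc k + j) # [1..<Suc k]) (gs ! j) k)"
    if "j < ?m" for j
    using that by (intro std_call_axm) (auto simp: meaning_def)
  ultimately show ?thesis using assms by (auto simp: Let_def)
qed

lemma std_PrimRec:
  assumes "A \<in> set (claim_axms b (PrimRec f g) k)"
  shows "std_sat N n A"
proof (cases k)
  case 0
  then show ?thesis
    using assms by (auto simp: Let_def meaning_def intro!: std_absurd elim: bcomp_PrimRecE)
next
  case (Suc m)
  let ?h = "PrimRec f g"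
  have "std_sat N n (Ax (map (Sort b) [0..<Suc k]) [Claim b ?h k 0]
    (map (\<lambda>(J, R). (map (Sort b) J, map (Claim b ?h k) R)) [([], [1]), ([k + 1, k + 2], [2])]))"
  proof (rule std_extend)
    fix e assume e: "meaning N ?h k 0 e" "\<forall>p<Suc k. e p \<le> N"
    have args: "map e [1..<Suc k] = e 1 # map e [2..<Suc k]" unfolding Suc upt_Suc_Suc_from_1 by simp
    from e(1) have "bcomp N ?h (e 1 # map e [2..<Suc k]) (e 0)"
      unfolding meaning_def args by simp
    then show "\<exists>(J, R)\<in>set [([], [1]), ([k + 1, k + 2], [2])]. \<exists>e'. (\<forall>p<Suc k. e' p = e p) \<and>
        (\<forall>p\<in>set J. e' p \<le> N) \<and> (\<forall>t\<in>set R. meaning N ?h k t e')"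
    proof (rule bcomp_PrimRecE)
      fix ys assume "e 1 # map e [2..<Suc k] = 0 # ys" "bcomp N f ys (e 0)"
      then have "meaning N ?h k 1 e" using Suc by (auto simp: meaning_def)
      then show ?thesis by auto
    next
      fix n' r ys
      assume *: "e 1 # map e [2..<Suc k] = Suc n' # ys" "bcomp N ?h (n' # ys) r" "r \<le> N"
        "bcomp N g (n' # r # ys) (e 0)"
      \<comment> \<open>The predecessor goes to position \<open>k + 1\<close> and the previous value
        to \<open>k + 2\<close>, as \<open>width\<close> provides.\<close>
      define e' where "e' p = (if p < Suc k then e p else if p = k + 1 then n' else r)" for p
      have "map e' [2..<Suc k] = ys" "e' 1 = Suc n'" using * Suc by (auto simp: e'_def)
      then have "meaning N ?h k 2 e'" using * Suc by (auto simp: meaning_def e'_def)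
      moreover have "n' \<le> N" using * e(2) Suc by auto
      ultimately show ?thesis using *(3) by (auto simp: e'_def intro!: exI[of _ e'])
    qed
  qed
  moreover have "std_sat N n (zero_axm (Claim b ?h k 1) b 1)"
    by (rule std_zero_axm) (auto simp: meaning_def)
  moreover have "std_sat N n (call_axm (Claim b ?h k 1) b (0 # [2..<Suc k]) f (k - 1))"
    by (rule std_call_axm) (auto simp: meaning_def)
  moreover have "std_sat N n A" if "A \<in> set (succ_axms (Claim b ?h k 2) b (k + 1) 1)"
    using that by (rule std_succ_axms[rotated]) (auto simp: meaning_def)
  moreover have "std_sat N n (call_axm (Claim b ?h k 2) b ((k + 2) # (k + 1) # [2..<Suc k]) ?h k)"
    using Suc by (intro std_call_axm) (auto simp: meaning_def numeral_2_eq_2)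
  moreover have "std_sat N n (call_axm (Claim b ?h k 2) b (0 # (k + 1) # (k + 2) # [2..<Suc k]) g (Suc k))"
    using Suc by (intro std_call_axm) (auto simp: meaning_def numeral_2_eq_2)
  ultimately show ?thesis using assms Suc by (auto simp: Let_def)
qed

lemma std_Mu:
  assumes "A \<in> set (claim_axms b (Mu f) k)"
  shows "std_sat N n A"
proof -
  let ?h = "Mu f"
  have mu: "bcomp N f (e 0 # map e [1..<Suc k]) 0"
      "\<forall>m<e 0. \<exists>r. Suc r \<le> N \<and> bcomp N f (m # map e [1..<Suc k]) (Suc r)"
    if "meaning N ?h k 0 e" for e
    using that by (auto simp: meaning_def elim: bcomp_MuE)
  have "std_sat N n (Ax (map (Sort b) [0..<Suc k]) [Claim b ?h k 0]
    (map (\<lambda>(J, R). (map (Sort b) J, map (Claim b ?h k) R)) [([k + 1], [1])]))"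
  proof (rule std_extend)
    fix e assume e: "meaning N ?h k 0 e"
    define e' where "e' = e(k + 1 := 0)"
    have "map e' [1..<Suc k] = map e [1..<Suc k]" "e' 0 = e 0" by (simp_all add: e'_def)
    then have "meaning N ?h k 1 e'"
      using mu(1)[OF e] by (simp add: meaning_def e'_def del: map_eq_conv)
    then show "\<exists>(J, R)\<in>set [([k + 1], [1])]. \<exists>e'. (\<forall>p<Suc k. e' p = e p) \<and>
        (\<forall>p\<in>set J. e' p \<le> N) \<and> (\<forall>t\<in>set R. meaning N ?h k t e')"
      by (auto simp: e'_def intro!: exI[of _ e'])
  qed
  moreover have "std_sat N n (zero_axm (Claim b ?h k 1) b (k + 1))"
    by (rule std_zero_axm) (auto simp: meaning_def)
  moreover have "std_sat N n (call_axm (Claim b ?h k 1) b ((k + 1) # 0 # [1..<Suc k]) f (Suc k))"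
    by (rule std_call_axm) (auto simp: meaning_def)
  moreover have "std_sat N n (Ax (sorts (Claim b ?h k 0) @ [Sort b (k + 1)])
      [Claim b ?h k 0, LT (Sort b (k + 1)) (Sort b 0)]
      [([Sort b (k + 2), Sort (\<not> b) 0], [Claim b ?h k 2, LT (Sort (\<not> b) 0) (Sort b (k + 2))])])"
    unfolding sat_def axm.sel
  proof (intro allI impI)
    fix a :: "sort \<Rightarrow> nat"
    assume "\<forall>i\<in>set (sorts (Claim b ?h k 0) @ [Sort b (k + 1)]). a i \<in> {..N}"
      and a: "\<forall>r\<in>set [Claim b ?h k 0, LT (Sort b (k + 1)) (Sort b 0)]. std_rel N n r a"
    let ?e = "\<lambda>p. a (Sort b p)"
    obtain r where r: "Suc r \<le> N" "bcomp N f (?e (k + 1) # map ?e [1..<Suc k]) (Suc r)"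
      using mu(2)[of ?e] a by auto
    \<comment> \<open>The added 0 witnesses that the value \<open>Suc r\<close> is positive.\<close>
    define a' where "a' = a(Sort b (k + 2) := Suc r, Sort (\<not> b) 0 := 0)"
    have "map (\<lambda>p. a' (Sort b p)) [1..<Suc k] = map ?e [1..<Suc k]" by (simp add: a'_def)
    then have "std_rel N n (Claim b ?h k 2) a'"
      using r by (simp add: meaning_def a'_def del: map_eq_conv)
    then show "\<exists>(J, R)\<in>set [([Sort b (k + 2), Sort (\<not> b) 0], [Claim b ?h k 2, LT (Sort (\<not> b) 0) (Sort b (k + 2))])].
       \<exists>a'. (\<forall>i\<in>set (sorts (Claim b ?h k 0) @ [Sort b (k + 1)]). a' i = a i) \<and>
        (\<forall>j\<in>set J. a' j \<in> {..N}) \<and> (\<forall>r\<in>set R. std_rel N n r a')"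
      using r(1) by (auto simp: a'_def intro!: exI[of _ a'])
  qed
  moreover have "std_sat N n (call_axm (Claim b ?h k 2) b ((k + 2) # (k + 1) # [1..<Suc k]) f (Suc k))"
    by (rule std_call_axm) (auto simp: meaning_def numeral_2_eq_2)
  ultimately show ?thesis using assms by (auto simp: Let_def)
qed

lemma std_claim_axms:
  assumes "A \<in> set (claim_axms b g k)"
  shows "std_sat N n A"
proof (cases g)
  case Zero
  then show ?thesis
    using assms by (auto simp: meaning_def intro!: std_zero_axm elim: bcomp_ZeroE)
next
  case Succ
  show ?thesis
  proof (cases "k = 1")
    case True
    have "meaning N Succ 1 0 e \<Longrightarrow> e 0 = Suc (e 1)" for e
      by (auto simp: meaning_def upt_Suc elim: bcomp_SuccE)
    then show ?thesis using assms Succ True by (auto simp: Let_def intro: std_succ_axms)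
  next
    case False
    have "\<not> meaning N Succ k 0 e" for e
    proof
      assume "meaning N Succ k 0 e"
      then obtain x where "map e [1..<Suc k] = [x]" by (auto simp: meaning_def elim: bcomp_SuccE)
      then have "length (map e [1..<Suc k]) = length [x]" by (rule arg_cong)
      then show False using False by simp
    qed
    then show ?thesis using assms Succ False by (auto simp: Let_def intro: std_absurd)
  qed
next
  case (Proj i)
  have *: "i < k \<and> e 0 = e (Suc i)" if "meaning N (Proj i) k 0 e" for e
    using that by (auto simp: meaning_def elim!: bcomp_ProjE)
  show ?thesis
  proof (cases "i < k")
    case True
    have v: "a (Sort b 0) = a (Sort b (Suc i))" if "std_rel N n (Claim b (Proj i) k 0) a" for a
      using *[of "\<lambda>p. a (Sort b p)"] that by simp
    then show ?thesis using assms Proj True 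
      by (auto simp: Let_def simp del: std_rel.simps(5) intro!: sat_plain)
        (simp_all only: v order_refl)
  next
    case False
    then show ?thesis using assms Proj * by (auto simp: Let_def intro!: std_absurd)
  qed
next
  case Comp
  then show ?thesis using assms std_Comp by blast
next
  case PrimRec
  then show ?thesis using assms std_PrimRec by blast
next
  case Mu
  then show ?thesis using assms std_Mu by blast
qed

section \<open>Numerals and the input\<close>

text \<open>A point denoting \<open>Suc k\<close> covers one denoting \<open>k\<close>. The copies
  alternate because two points of one sort cannot be compared; \<open>Sort b 0\<close> serves to
  exclude numbers in between.\<close>

definition num_step :: "bool \<Rightarrow> nat \<Rightarrow> axm list" where
  "num_step b k =
    [Ax [Sort b 1] [Num b (Suc k)] [([Sort (\<not> b) 1], [Num (\<not> b) k, LT (Sort (\<not> b) 1) (Sort b 1)])],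
     Ax [Sort b 1, Sort (\<not> b) 1, Sort b 0]
       [Num b (Suc k), Num (\<not> b) k, LT (Sort (\<not> b) 1) (Sort b 0), LT (Sort b 0) (Sort b 1)] []]"

definition num_base :: "bool \<Rightarrow> axm" where
  "num_base b = Ax [Sort b 1, Sort (\<not> b) 0] [Num b 0, LT (Sort (\<not> b) 0) (Sort b 1)] []"

definition num_input :: "nat \<Rightarrow> axm" where
  "num_input n = Ax [Sort False 1] [Inp] [([], [Num False n])]"

definition num_axms :: "nat \<Rightarrow> axm set" where
  "num_axms n = insert (num_input n) ({num_base False, num_base True} \<union>
    (\<Union>k<n. set (num_step False k @ num_step True k)))"

text \<open>Primitive recursion makes the code of the formula computable from the numeral.\<close>

primrec num_chain :: "nat \<Rightarrow> form" where
  "num_chain 0 = conj (map ax_form [num_base False, num_base True])"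
| "num_chain (Suc k) = And (conj (map ax_form (num_step False k @ num_step True k))) (num_chain k)"

definition num_form :: "nat \<Rightarrow> form" where
  "num_form n = And (ax_form (num_input n)) (num_chain n)"

lemma frc_num_form: "frc V s (num_form n) \<longleftrightarrow> (\<forall>A\<in>num_axms n. frc V s (ax_form A))"
proof -
  have "frc V s (num_chain n) \<longleftrightarrow> (\<forall>A\<in>{num_base False, num_base True} \<union>
    (\<Union>k<n. set (num_step False k @ num_step True k)). frc V s (ax_form A))" for n
  proof (induction n)
    case 0
    show ?case by (simp add: frc_conj)
  next
    case (Suc n)
    then show ?case
      unfolding num_chain.simps frc.simps(3) frc_conj set_map lessThan_Suc by blast
  qed
  then show ?thesis unfolding num_form_def num_axms_def frc.simps(3) by blast
qed

lemma num_axms_cases: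
  assumes "A \<in> num_axms n"
  obtains "A = num_input n" | b where "A = num_base b" | b k where "k < n" "A \<in> set (num_step b k)"
  using assms unfolding num_axms_def by auto

lemma wf_num_axms: "A \<in> num_axms n \<Longrightarrow> wf_axm A"
  by (erule num_axms_cases) (auto simp: wf_axm_def num_input_def num_base_def num_step_def)

text \<open>The sorts do not grow with \<open>n\<close>, so the sorts of the program theory can be
  fixed before the input is known.\<close>

lemma num_axms_sorts: "A \<in> num_axms n \<Longrightarrow> asorts A \<subseteq> {Sort b p |b p. p < 2}"
  by (erule num_axms_cases) (auto simp: asorts_def num_input_def num_base_def num_step_def)

lemma std_num_axms:
  assumes "A \<in> num_axms n"
  shows "std_sat N n A"
  using assms
proof (cases rule: num_axms_cases)
  case 1
  then show ?thesis by (auto simp: sat_def num_input_def)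
next
  case (2 b)
  then show ?thesis by (auto simp: sat_def num_base_def)
next
  case (3 b k)
  have "std_sat N n (Ax [Sort b 1] [Num b (Suc k)]
      [([Sort (\<not> b) 1], [Num (\<not> b) k, LT (Sort (\<not> b) 1) (Sort b 1)])])"
    unfolding sat_def axm.sel
  proof (intro allI impI)
    fix a :: "sort \<Rightarrow> nat"
    assume "\<forall>i\<in>set [Sort b 1]. a i \<in> {..N}" "\<forall>r\<in>set [Num b (Suc k)]. std_rel N n r a"
    then show "\<exists>(J, R)\<in>set [([Sort (\<not> b) 1], [Num (\<not> b) k, LT (Sort (\<not> b) 1) (Sort b 1)])].
      \<exists>a'. (\<forall>i\<in>set [Sort b 1]. a' i = a i) \<and> (\<forall>j\<in>set J. a' j \<in> {..N}) \<and>
        (\<forall>r\<in>set R. std_rel N n r a')"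
      \<comment> \<open>The witness \<open>k\<close> is in the domain because the given point
        \<open>Suc k\<close> is.\<close>
      by (auto intro!: exI[of _ "a(Sort (\<not> b) 1 := k)"])
  qed
  moreover have "std_sat N n (Ax [Sort b 1, Sort (\<not> b) 1, Sort b 0]
       [Num b (Suc k), Num (\<not> b) k, LT (Sort (\<not> b) 1) (Sort b 0), LT (Sort b 0) (Sort b 1)] [])"
    by (auto simp: sat_def)
  ultimately show ?thesis using 3 by (auto simp: num_step_def)
qed

text \<open>Induction on \<open>k\<close>, switching copies: the point covers one of value
  \<open>k\<close>, and a gap would be filled by \<open>onto\<close>.\<close>

lemma (in numbers) num_value:
  assumes "\<And>A. A \<in> num_axms n \<Longrightarrow> ok A" "k \<le> n" "rel (Num b k) a" "a (Sort b 1) \<in> D (Sort b 1)"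
  shows "val (Sort b 1) (a (Sort b 1)) = k"
  using assms(2-)
proof (induction k arbitrary: b a)
  case 0
  show ?case
  proof (rule ccontr)
    assume nz: "val (Sort b 1) (a (Sort b 1)) \<noteq> 0"
    have ok: "ok (num_base b)" using assms(1) by (cases b) (auto simp: num_axms_def)
    then have U: "Sort b 1 \<in> U" "Sort (\<not> b) 0 \<in> U" by (auto simp: ok_def num_base_def asorts_def)
    obtain y where y: "y \<in> D (Sort (\<not> b) 0)" "val (Sort (\<not> b) 0) y = 0"
      using onto[OF U _ 0(3), of 0] nz by auto
    let ?a = "a(Sort (\<not> b) 0 := y)"
    have "rel (Num b 0) ?a" using 0(2) by (subst rel_upd) auto
    moreover have "rel (LT (Sort (\<not> b) 0) (Sort b 1)) ?a"
      using rel_lt[OF U(2,1), of ?a] y 0(3) nz by simp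
    ultimately show False
      using ok[unfolded ok_def sat_def num_base_def axm.sel, THEN conjunct1, THEN spec[of _ ?a]] y 0(3)
      by simp
  qed
next
  case (Suc k)
  let ?v = "Sort b 1" and ?w = "Sort (\<not> b) 1" and ?z = "Sort b 0"
  have "A \<in> num_axms n" if "A \<in> set (num_step b k)" for A
    using that Suc.prems(1) unfolding num_axms_def by (cases b) auto
  then have ok: "ok (Ax [?v] [Num b (Suc k)] [([?w], [Num (\<not> b) k, LT ?w ?v])])"
    "ok (Ax [?v, ?w, ?z] [Num b (Suc k), Num (\<not> b) k, LT ?w ?z, LT ?z ?v] [])"
    using assms(1) by (simp_all add: num_step_def)
  then have U: "?v \<in> U" "?w \<in> U" "?z \<in> U" by (auto simp: ok_def asorts_def)
  from ok(1)[unfolded ok_def sat_def axm.sel, THEN conjunct1, THEN spec[of _ a]] Suc.prems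
  obtain a' where a': "a' ?v = a ?v" "a' ?w \<in> D ?w" "rel (Num (\<not> b) k) a'" "rel (LT ?w ?v) a'"
    by auto
  have w: "val ?w (a' ?w) = k" using Suc.IH[of "\<not> b" a'] Suc.prems(1) a' by simp
  have less: "k < val ?v (a ?v)"
    using rel_lt[OF U(2,1), of a'] a' w Suc.prems(3) by simp
  show ?case
  proof (rule ccontr)
    assume "val ?v (a ?v) \<noteq> Suc k"
    then have gap: "Suc k < val ?v (a ?v)" using less by simp
    obtain y where y: "y \<in> D ?z" "val ?z y = Suc k"
      using onto[OF U(1,3) _ Suc.prems(3) gap] by auto
    let ?a = "a'(?z := y)"
    have "rel (Num b (Suc k)) ?a"
      using Suc.prems(2) a'(1) by (subst local_relD[OF loc, of _ _ a]) auto
    moreover have "rel (Num (\<not> b) k) ?a" using a'(3) by (subst rel_upd) auto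
    moreover have "rel (LT ?w ?z) ?a" "rel (LT ?z ?v) ?a"
      using rel_lt[OF U(2,3), of ?a] rel_lt[OF U(3,1), of ?a] y a'(1,2) w gap Suc.prems(3) by simp_all
    ultimately show False
      using ok(2)[unfolded ok_def sat_def axm.sel, THEN conjunct1, THEN spec[of _ ?a]] y a'(1,2) Suc.prems(3)
      by simp
  qed
qed

section \<open>The theory of a program with its input\<close>

text \<open>The sort \<open>Sort True 1\<close> is a dummy, as every axiom needs a universal sort.\<close>

definition start_axm :: "recf \<Rightarrow> axm" where
  "start_axm f = Ax [Sort True 1] [] [([Sort False 0, Sort False 1, Sort True 0],
    [Claim False f 1 0, Inp, LT (Sort True 0) (Sort False 0)])]"

definition sorts_below :: "nat \<Rightarrow> sort list" where
  "sorts_below P = map (Sort False) [0..<P] @ map (Sort True) [0..<P]"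

text \<open>The sorts reach one position beyond \<open>P\<close>, which leaves
  \<open>Sort False P\<close> free as the yardstick when the program axioms stay below
  \<open>P\<close>.\<close>

definition prog_form :: "recf \<Rightarrow> nat \<Rightarrow> form" where
  "prog_form f P = theory_form (sorts_below (Suc P))
    (base_axms (sorts_below (Suc P)) @ start_axm f # prog_axms f 1)"

lemma std_start_axm:
  assumes "bcomp N f [n] y" "0 < y" "n \<le> N" "y \<le> N"
  shows "std_sat N n (start_axm f)"
  unfolding sat_def start_axm_def axm.sel
proof (intro allI impI)
  fix a :: "sort \<Rightarrow> nat"
  assume a: "\<forall>i\<in>set [Sort True 1]. a i \<in> {..N}"
  let ?a = "a(Sort False 0 := y, Sort False 1 := n, Sort True 0 := 0)"
  have "std_rel N n (Claim False f 1 0) ?a"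
    using assms(1) by (simp add: meaning_def upt_Suc)
  then have "\<forall>r\<in>set [Claim False f 1 0, Inp, LT (Sort True 0) (Sort False 0)]. std_rel N n r ?a"
    using assms(2) by simp
  moreover have "\<forall>j\<in>set [Sort False 0, Sort False 1, Sort True 0]. ?a j \<in> {..N}"
    "\<forall>i\<in>set [Sort True 1]. ?a i = a i"
    using assms(3,4) by simp_all
  ultimately show "\<exists>(J, R)\<in>set [([Sort False 0, Sort False 1, Sort True 0],
      [Claim False f 1 0, Inp, LT (Sort True 0) (Sort False 0)])].
    \<exists>a'. (\<forall>i\<in>set [Sort True 1]. a' i = a i) \<and> (\<forall>j\<in>set J. a' j \<in> {..N}) \<and>
      (\<forall>r\<in>set R. std_rel N n r a')"
    by (intro bexI[of _ "([Sort False 0, Sort False 1, Sort True 0],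
      [Claim False f 1 0, Inp, LT (Sort True 0) (Sort False 0)])"]) (unfold prod.case, blast, simp)
qed

lemma wf_start_axm: "wf_axm (start_axm f)"
  by (auto simp: wf_axm_def start_axm_def upt_Suc)

text \<open>The numbers up to a bound on the computation, its input and its value form a finite
  structure satisfying all axioms.\<close>

lemma refutable_if_computes:
  assumes "computes f [n] y" "0 < y"
  shows "Imp (num_form n) (prog_form f P) \<notin> Sch Inq"
proof -
  obtain M where "bcomp M f [n] y" using computes_bounded[OF assms(1)] by blast
  define N where "N = max M (max n y)"
  have N: "bcomp N f [n] y" "n \<le> N" "y \<le> N"
    using bcomp_mono[OF \<open>bcomp M f [n] y\<close>, of N] by (simp_all add: N_def)
  show ?thesis
    unfolding prog_form_def
  proof (rule refutable_if_sat[OF _ local_std_rel])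
    show "sorts_below (Suc P) \<noteq> []" by (simp add: sorts_below_def)
  next
    fix A assume "A \<in> set (base_axms (sorts_below (Suc P)) @ start_axm f # prog_axms f 1)"
    then consider "A \<in> set (base_axms (sorts_below (Suc P)))" | "A = start_axm f"
      | b g k where "A \<in> set (claim_axms b g k)"
      unfolding prog_axms_def by auto
    then show "wf_axm A \<and> std_sat N n A"
      using wf_base_axms wf_claim_axms wf_start_axm std_base_axms std_claim_axms
        std_start_axm[OF N(1) assms(2) N(2,3)] by cases metis+
  next
    fix s :: "(sort \<times> nat) set" assume "s \<subseteq> UNIV \<times> {..N}"
    then show "frc (std N (std_rel N n)) s (num_form n)"
      unfolding frc_num_form by (intro ballI std_ax_form local_std_rel std_num_axms wf_num_axms)
  qed
qed

lemma set_sorts_below: "set (sorts_below P) = {Sort b p |b p. p < P}"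
proof -
  have "Sort b p \<in> set (sorts_below P) \<longleftrightarrow> p < P" for b p
    by (cases b) (auto simp: sorts_below_def)
  then show ?thesis by (auto intro: sort.exhaust) (metis sort.exhaust)
qed

text \<open>In any finite structure the start axiom supplies a claim with the input as argument and
  a positive value; soundness of claims turns it into a computation.\<close>

lemma computes_if_refutable:
  assumes "Imp (num_form n) (prog_form f P) \<notin> Sch Inq"
    and P: "\<And>A. A \<in> set (start_axm f # prog_axms f 1) \<Longrightarrow> asorts A \<subseteq> set (sorts_below P)"
  shows "\<exists>y>0. computes f [n] y"
proof -
  let ?S = "sorts_below (Suc P)"
  have "asorts (start_axm f) \<subseteq> set (sorts_below P)" using P by simp
  then have P2: "1 < P" by (auto simp: start_axm_def asorts_def set_sorts_below)
  have SP: "set (sorts_below P) \<subseteq> set ?S" by (auto simp: set_sorts_below)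
  have "{Sort b p |b p. p < 2} \<subseteq> set (sorts_below P)" using P2 unfolding set_sorts_below by auto
  then have num: "asorts A \<subseteq> set (sorts_below P)" if "A \<in> num_axms n" for A
    using num_axms_sorts[OF that] by (rule subset_trans[rotated])
  have wf: "wf_axm A \<and> asorts A \<subseteq> set ?S"
    if A: "A \<in> set (base_axms ?S @ start_axm f # prog_axms f 1) \<union> num_axms n" for A
  proof -
    consider "A \<in> set (base_axms ?S)" | "A \<in> set (start_axm f # prog_axms f 1)" | "A \<in> num_axms n"
      using A by auto
    then show ?thesis
    proof cases
      case 1
      then show ?thesis by (rule wf_base_axms)
    next
      case 2
      then have "wf_axm A" using wf_start_axm wf_prog_axms by auto
      then show ?thesis using P[OF 2] SP by blast
    next
      case 3
      then show ?thesis using wf_num_axms num SP by blast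
    qed
  qed
  have form: "frc V s (ax_form A)" if "frc V s (num_form n)" "A \<in> num_axms n" for V and s :: state and A
    using that unfolding frc_num_form by blast
  obtain D :: "sort \<Rightarrow> valuation set" and rel where D: "\<And>i. finite (D i)"
      "\<And>i. i \<in> set ?S \<Longrightarrow> D i \<noteq> {}" "local_rel rel"
      "\<And>A. A \<in> set (base_axms ?S @ start_axm f # prog_axms f 1) \<union> num_axms n \<Longrightarrow> sat D rel A"
    using sat_if_refutable[OF assms(1)[unfolded prog_form_def] wf form] by blast
  let ?r0 = "Sort False P"
  have r0: "?r0 \<in> set ?S" by (auto simp: set_sorts_below)
  have base: "sat D rel A" if "A \<in> set (base_axms ?S)" for A using D(4) that by simp
  obtain val where "numbers D rel val (set ?S - {?r0})"
    by (rule number_structure[OF D(1) D(3) base r0])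
  then interpret numbers D rel val "set ?S - {?r0}" .
  have U: "set (sorts_below P) \<subseteq> set ?S - {?r0}" by (auto simp: set_sorts_below)
  have ok: "ok A" if "A \<in> set (start_axm f # prog_axms f 1) \<union> num_axms n" for A
    unfolding ok_def using that D(4)[of A] P[of A] num[of A] U by auto
  have "sound f 1"
    by (rule sound_claims, rule ok) (simp add: claim_axms_in_prog_axms del: One_nat_def)
  obtain x where x: "x \<in> D (Sort True 1)"
    using D(2)[of "Sort True 1"] P2 by (auto simp: set_sorts_below)
  have "ok (start_axm f)" using ok by simp
  from this[unfolded ok_def start_axm_def sat_def axm.sel, THEN conjunct1, THEN spec[of _ "\<lambda>_. x"]] x
  obtain a where a: "a (Sort False 0) \<in> D (Sort False 0)" "a (Sort False 1) \<in> D (Sort False 1)"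
      "a (Sort True 0) \<in> D (Sort True 0)"
      "rel (Claim False f 1 0) a" "rel Inp a" "rel (LT (Sort True 0) (Sort False 0)) a"
    by auto
  have "within False (Suc 1) a" using a(1,2) by (auto simp: within_def less_Suc_eq)
  then have "computes f (map (ev False a) [1..<Suc 1]) (ev False a 0)"
    by (rule \<open>sound f 1\<close>[unfolded sound_def, rule_format, OF a(4)])
  then have "computes f [ev False a 1] (ev False a 0)" by (simp add: upt_Suc)
  moreover have "ev False a 0 > 0"
  proof -
    have "Sort True 0 \<in> set ?S - {?r0}" "Sort False 0 \<in> set ?S - {?r0}"
      using P2 by (auto simp: set_sorts_below)
    from rel_lt[OF this _ a(3,1)] a(6) show ?thesis by (simp add: ev_def)
  qed
  moreover have "ev False a 1 = n"
  proof -
    have "ok (num_input n)" by (intro ok) (simp add: num_axms_def)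
    from this[unfolded ok_def num_input_def sat_def axm.sel, THEN conjunct1, THEN spec[of _ a]] a
    obtain a' where a': "a' (Sort False 1) = a (Sort False 1)" "rel (Num False n) a'" by auto
    have "val (Sort False 1) (a' (Sort False 1)) = n"
      by (rule num_value[OF _ order_refl a'(2)]) (use ok a a' in auto)
    then show ?thesis using a' by (simp add: ev_def)
  qed
  ultimately show ?thesis by auto
qed

section \<open>Computing the code of the numerals\<close>

definition recursive :: "nat \<Rightarrow> (nat list \<Rightarrow> nat) \<Rightarrow> bool" where
  "recursive k F \<longleftrightarrow> (\<exists>p. \<forall>xs. length xs = k \<longrightarrow> computes p xs (F xs))"

lemma recursive_nth: "i < k \<Longrightarrow> recursive k (\<lambda>xs. xs ! i)"
  unfolding recursive_def by (rule exI[of _ "Proj i"]) (auto intro: computes.Proj)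

lemma recursive_comp1:
  assumes "recursive 1 (\<lambda>xs. g (xs ! 0))" "recursive k F"
  shows "recursive k (\<lambda>xs. g (F xs))"
proof -
  obtain p q where p: "\<forall>xs. length xs = 1 \<longrightarrow> computes p xs (g (xs ! 0))"
    and q: "\<forall>xs. length xs = k \<longrightarrow> computes q xs (F xs)" using assms unfolding recursive_def by blast
  have "computes (Comp p [q]) xs (g (F xs))" if "length xs = k" for xs
    using p[rule_format, of "[F xs]"] q that by (auto intro!: computes.Comp[where ys = "[F xs]"])
  then show ?thesis unfolding recursive_def by blast
qed

lemma recursive_comp2:
  assumes "recursive 2 (\<lambda>xs. g (xs ! 0) (xs ! 1))" "recursive k F" "recursive k G"
  shows "recursive k (\<lambda>xs. g (F xs) (G xs))"
proof -
  obtain p q r where p: "\<forall>xs. length xs = 2 \<longrightarrow> computes p xs (g (xs ! 0) (xs ! 1))"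
    and q: "\<forall>xs. length xs = k \<longrightarrow> computes q xs (F xs)"
    and r: "\<forall>xs. length xs = k \<longrightarrow> computes r xs (G xs)" using assms unfolding recursive_def by metis
  have "computes (Comp p [q, r]) xs (g (F xs) (G xs))" if "length xs = k" for xs
    using p[rule_format, of "[F xs, G xs]"] q r that
    by (auto intro!: computes.Comp[where ys = "[F xs, G xs]"])
  then show ?thesis unfolding recursive_def by blast
qed

lemma recursive_Suc: "recursive k F \<Longrightarrow> recursive k (\<lambda>xs. Suc (F xs))"
proof (rule recursive_comp1[of Suc])
  have "computes Succ xs (Suc (xs ! 0))" if "length xs = 1" for xs
    using that by (cases xs) (auto intro: computes.Succ)
  then show "recursive 1 (\<lambda>xs. Suc (xs ! 0))" unfolding recursive_def by blast
qed

lemma recursive_const: "recursive k (\<lambda>xs. c)"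
proof (induction c)
  case 0
  show ?case unfolding recursive_def using computes.Zero by blast
qed (rule recursive_Suc)

lemma recursive_rec_nat:
  assumes "recursive k F" "recursive (Suc (Suc k)) G"
  shows "recursive (Suc k) (\<lambda>xs. rec_nat (F (tl xs)) (\<lambda>n r. G (n # r # tl xs)) (hd xs))"
proof -
  obtain p q where p: "\<forall>xs. length xs = k \<longrightarrow> computes p xs (F xs)"
    and q: "\<forall>xs. length xs = Suc (Suc k) \<longrightarrow> computes q xs (G xs)" using assms unfolding recursive_def by blast
  have "computes (PrimRec p q) (m # ys) (rec_nat (F ys) (\<lambda>n r. G (n # r # ys)) m)"
    if "length ys = k" for m ys
    using p q that by (induction m) (auto intro: computes.PrimRec_0 computes.PrimRec_Suc)
  then have "computes (PrimRec p q) xs (rec_nat (F (tl xs)) (\<lambda>n r. G (n # r # tl xs)) (hd xs))"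
    if "length xs = Suc k" for xs
    using that by (cases xs) auto
  then show ?thesis unfolding recursive_def by blast
qed

lemma recursive_rec1:
  assumes "recursive 2 (\<lambda>xs. g (xs ! 0) (xs ! 1))"
  shows "recursive 1 (\<lambda>xs. rec_nat c g (xs ! 0))"
proof -
  have "recursive (Suc 0) (\<lambda>xs. rec_nat c (\<lambda>n r. g ((n # r # tl xs) ! 0) ((n # r # tl xs) ! 1)) (hd xs))"
    by (rule recursive_rec_nat[OF recursive_const]) (use assms in \<open>simp add: numeral_2_eq_2\<close>)
  then obtain p where "\<forall>xs. length xs = 1 \<longrightarrow> computes p xs (rec_nat c g (hd xs))"
    unfolding recursive_def by auto
  then have "\<forall>xs. length xs = 1 \<longrightarrow> computes p xs (rec_nat c g (xs ! 0))"
    by (metis One_nat_def hd_conv_nth length_0_conv nat.distinct(1))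
  then show ?thesis unfolding recursive_def by blast
qed

lemma recursive_add: "recursive k F \<Longrightarrow> recursive k G \<Longrightarrow> recursive k (\<lambda>xs. F xs + G xs)"
proof (rule recursive_comp2[of "(+)"])
  have "recursive (Suc 1) (\<lambda>xs. rec_nat (tl xs ! 0) (\<lambda>n r. Suc ((n # r # tl xs) ! 1)) (hd xs))"
    by (rule recursive_rec_nat) (auto intro: recursive_nth recursive_Suc)
  moreover have "rec_nat b (\<lambda>n r. Suc r) a = a + b" for a b :: nat by (induction a) auto
  moreover have "xs ! 0 + xs ! 1 = hd xs + tl xs ! 0" if "length xs = 2" for xs :: "nat list"
    using that by (cases xs; cases "tl xs") auto
  ultimately show "recursive 2 (\<lambda>xs. xs ! 0 + xs ! 1)"
    unfolding recursive_def by (simp add: numeral_2_eq_2)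
qed

text \<open>The pairing is \<open>triangle (m + n) + m\<close>, and triangular numbers arise by
  primitive recursion.\<close>

lemma recursive_prod_encode: "recursive k F \<Longrightarrow> recursive k G \<Longrightarrow> recursive k (\<lambda>xs. prod_encode (F xs, G xs))"
proof (rule recursive_comp2[of "\<lambda>m n. prod_encode (m, n)"])
  have "triangle m = rec_nat 0 (\<lambda>n r. r + Suc n) m" for m by (induction m) auto
  moreover have "recursive 2 (\<lambda>xs. xs ! 1 + Suc (xs ! 0))"
    by (intro recursive_add recursive_Suc recursive_nth) simp_all
  ultimately have "recursive 1 (\<lambda>xs. triangle (xs ! 0))"
    using recursive_rec1[of "\<lambda>n r. r + Suc n" 0] by simp
  then have "recursive 2 (\<lambda>xs. triangle (xs ! 0 + xs ! 1))"
    by (rule recursive_comp1[of triangle]) (intro recursive_add recursive_nth; simp)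
  then have "recursive 2 (\<lambda>xs. triangle (xs ! 0 + xs ! 1) + xs ! 0)"
    by (intro recursive_add recursive_nth) simp_all
  then show "recursive 2 (\<lambda>xs. prod_encode (xs ! 0, xs ! 1))"
    by (simp add: prod_encode_def)
qed

lemma recursive_code_const: "recursive k (\<lambda>xs. form_code \<phi>)"
  by (rule recursive_const)

lemma recursive_code_And:
  "recursive k (\<lambda>xs. form_code (S xs)) \<Longrightarrow> recursive k (\<lambda>xs. form_code (T xs)) \<Longrightarrow>
    recursive k (\<lambda>xs. form_code (And (S xs) (T xs)))"
  unfolding form_code.simps by (intro recursive_prod_encode recursive_const)

lemma recursive_code_Or:
  "recursive k (\<lambda>xs. form_code (S xs)) \<Longrightarrow> recursive k (\<lambda>xs. form_code (T xs)) \<Longrightarrow>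
    recursive k (\<lambda>xs. form_code (Or (S xs) (T xs)))"
  unfolding form_code.simps by (intro recursive_prod_encode recursive_const)

lemma recursive_code_Imp:
  "recursive k (\<lambda>xs. form_code (S xs)) \<Longrightarrow> recursive k (\<lambda>xs. form_code (T xs)) \<Longrightarrow>
    recursive k (\<lambda>xs. form_code (Imp (S xs) (T xs)))"
  unfolding form_code.simps by (intro recursive_prod_encode recursive_const)

text \<open>The explicit indices of numeral letters pay off here: the code of such a letter is a
  pairing of constants with the varying numeral.\<close>

lemma recursive_code_Num: "recursive k F \<Longrightarrow> recursive k (\<lambda>xs. form_code (letter (Rel (Num b (F xs)))))"
  unfolding form_code.simps letter_index_def lett.case rsym.case by (intro recursive_prod_encode recursive_const)

lemmas recursive_code = recursive_code_const recursive_code_And recursive_code_Or recursive_code_Imp recursive_code_Num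

lemma recursive_num_form: "recursive 1 (\<lambda>xs. form_code (num_form (xs ! 0)))"
proof -
  let ?step = "\<lambda>k. conj (map ax_form (num_step False k @ num_step True k))"
  \<comment> \<open>Unfolding exposes a formula of fixed shape in which \<open>k\<close> occurs in
    numeral letters only; every subformula without \<open>k\<close> has a constant code.\<close>
  have step: "recursive 1 (\<lambda>xs. form_code (?step (xs ! 0)))"
    unfolding num_step_def ax_form_def on_def append.simps list.map conj.simps disj.simps axm.sel
      prod.case concat.simps sorts.simps fst_conv
    by (rule recursive_code | rule recursive_Suc | rule recursive_nth, simp)+
  have input: "recursive 1 (\<lambda>xs. form_code (ax_form (num_input (xs ! 0))))"
    unfolding num_input_def ax_form_def on_def append.simps list.map conj.simps disj.simps axm.sel
      prod.case concat.simps sorts.simps fst_conv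
    by (rule recursive_code | rule recursive_Suc | rule recursive_nth, simp)+
  have "form_code (num_chain n) =
      rec_nat (form_code (num_chain 0)) (\<lambda>k r. prod_encode (2, prod_encode (form_code (?step k), r))) n" for n
    by (induction n) simp_all
  moreover have "recursive 1 (\<lambda>xs. rec_nat (form_code (num_chain 0))
      (\<lambda>k r. prod_encode (2, prod_encode (form_code (?step k), r))) (xs ! 0))"
    by (intro recursive_rec1 recursive_prod_encode recursive_const recursive_nth recursive_comp1[of "\<lambda>k. form_code (?step k)", OF step]) simp_all
  ultimately have "recursive 1 (\<lambda>xs. form_code (num_chain (xs ! 0)))" by simp
  then show ?thesis unfolding num_form_def by (intro recursive_code_And input)
qed

section \<open>Undecidability\<close>

theorem corollary1p9: "\<not> decidable (Sch Inq)"
proof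
  assume "decidable (Sch Inq)"
  then obtain d where d: "\<And>\<phi>. computes d [form_code \<phi>] (if \<phi> \<in> Sch Inq then 1 else 0)"
    unfolding decidable_def by blast
  \<comment> \<open>The program \<open>p\<close> turns the code \<open>m\<close> of a formula into
    the code of its implication from \<open>num_form m\<close>; the tag 4 is that of
    \<open>Imp\<close>.\<close>
  have "recursive 1 (\<lambda>xs. prod_encode (4, prod_encode (form_code (num_form (xs ! 0)), xs ! 0)))"
    by (intro recursive_prod_encode recursive_const recursive_num_form recursive_nth) simp
  then obtain p where "\<forall>xs. length xs = 1 \<longrightarrow>
      computes p xs (prod_encode (4, prod_encode (form_code (num_form (xs ! 0)), xs ! 0)))"
    unfolding recursive_def by blast
  then have p: "computes p [m] (prod_encode (4, prod_encode (form_code (num_form m), m)))" for m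
    by (auto dest: spec[of _ "[m]"])
  define f where "f = Comp d [p]"
  \<comment> \<open>A strict bound on all positions in the axioms for \<open>f\<close>. It depends
    on \<open>f\<close> alone, so the code of \<open>prog_form f P\<close> can serve as input
    afterwards.\<close>
  define P where "P = Suc (Max (\<Union>A\<in>set (start_axm f # prog_axms f 1). {q. \<exists>b. Sort b q \<in> asorts A}))"
  have P: "asorts A \<subseteq> set (sorts_below P)" if "A \<in> set (start_axm f # prog_axms f 1)" for A
  proof
    fix i assume i: "i \<in> asorts A"
    obtain b q where bq: "i = Sort b q" by (cases i)
    have "finite {q. \<exists>b. Sort b q \<in> asorts A}" for A
    proof (rule finite_subset)
      show "{q. \<exists>b. Sort b q \<in> asorts A} \<subseteq> (\<lambda>i. case i of Sort b q \<Rightarrow> q) ` asorts A" by force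
    qed (simp add: asorts_def)
    then have "q \<le> Max (\<Union>A\<in>set (start_axm f # prog_axms f 1). {q. \<exists>b. Sort b q \<in> asorts A})"
      using that i bq by (intro Max_ge) auto
    then show "i \<in> set (sorts_below P)" unfolding set_sorts_below P_def bq by auto
  qed
  \<comment> \<open>The diagonal step: \<open>f\<close> is run on the code of its own theory, so it
    returns the verdict of \<open>d\<close> on \<open>?\<theta>\<close>, whose refutability means
    that \<open>f\<close> returns a positive value.\<close>
  define k where "k = form_code (prog_form f P)"
  let ?\<theta> = "Imp (num_form k) (prog_form f P)"
  have "computes (Comp d [p]) [k] (if ?\<theta> \<in> Sch Inq then 1 else 0)"
  proof (rule computes.Comp)
    show "list_all2 (\<lambda>g y. computes g [k] y) [p] [form_code ?\<theta>]"
      using p[of k] by (simp add: k_def)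
  qed (rule d)
  then have f: "computes f [k] (if ?\<theta> \<in> Sch Inq then 1 else 0)"
    unfolding f_def[symmetric] .
  \<comment> \<open>The verdict 1 makes \<open>?\<theta>\<close> refutable, and the verdict 0
    asserts refutability and so forces a positive value; either way \<open>f\<close> contradicts the
    formula about it.\<close>
  show False
  proof (cases "?\<theta> \<in> Sch Inq")
    case True
    then show False using refutable_if_computes[of f k 1 P] f by simp
  next
    case False
    then obtain y where "y > 0" "computes f [k] y" using computes_if_refutable P by blast
    then show False using computes_deterministic[OF f] False by fastforce
  qed
qed

end
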